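(* Let $A,B\subset\mathbb{R}^m$ be closed sets in the smooth transverse setting (see context) and let $x^*\in A\cap B$ be the transversal intersection point. Then $x^*$ is an equilibrium of $\dot x=v(x)$, and there exist constants $\mu>0$, $C\ge1$ and a neighborhood $U$ of $x^*$ such that for any solution $x(\cdot)$ of $\dot x=v(x)$ with $x(0)\in U$, $$\|v(x(t))\|\le C e^{-\mu t}\|v(x(0))\|\qquad\text{for all } t\ge0.$$ In particular, for any $\delta>0$ and any $x(0)\in U$ with $\|v(x(0))\|>\delta$, $$T^*_\delta(x(0))\le \mu^{-1}\log\Bigl(\frac{C\|v(x(0))\|}{\delta}\Bigr)<\infty .$$
   Context: For closed sets $A,B\subset\mathbb{R}^m$ let $P_A,P_B$ be the metric (nearest-point) projections, $R_A:=2P_A-\mathrm{Id}$, and $v(x):=P_B(R_Ax)-P_Ax$ (the RRR flow field). Smooth transverse setting: $A$ and $B$ are $C^2$ embedded submanifolds of $\mathbb{R}^m$ that intersect transversally at $x^*\in A\cap B$. In a sufficiently small neighborhood of $x^*$ the projections $P_A$ and $P_B$ are single-valued and $C^1$, and their derivatives at $x^*$ are the orthogonal projectors onto $T_{x^*}A$, $T_{x^*}B$. The intersection $M:=A\cap B$ is then a $C^2$ submanifold, and $P_A,P_B$ restrict to the identity on $M$ near $x^*$. Hitting time: for $\delta>0$ and the solution $x(\cdot)$ of $\dot x=v(x)$ with $x(0)=x_0$, $T^*_\delta(x_0):=\inf\{t\ge0:\|v(x(t))\|\le\delta\}$, with value $+\infty$ if the set is empty. *)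

theory Defs
  imports "HOL-Analysis.Analysis"
begin

section \<open>$C^2$ maps and $C^2$ embedded submanifolds\<close>

text \<open>
  Twice continuously Frechet differentiable on \<open>S\<close>; used for open \<open>S\<close> only.
\<close>

definition C2_on :: "('a::real_normed_vector \<Rightarrow> 'b::real_normed_vector) \<Rightarrow> 'a set \<Rightarrow> bool" where
  "C2_on f S \<longleftrightarrow>
    (\<exists>(f' :: 'a \<Rightarrow> 'a \<Rightarrow>\<^sub>L 'b) (f'' :: 'a \<Rightarrow> 'a \<Rightarrow>\<^sub>L ('a \<Rightarrow>\<^sub>L 'b)).
      (\<forall>x\<in>S. (f has_derivative blinfun_apply (f' x)) (at x)) \<and>
      (\<forall>x\<in>S. (f' has_derivative blinfun_apply (f'' x)) (at x)) \<and>
      continuous_on S f'')"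

text \<open>
  \<open>S\<close> is a \<open>k\<close>-dimensional embedded $C^2$ submanifold of the ambient space: near each of its
  points, an ambient $C^2$ diffeomorphism \<open>\<phi>\<close> (with inverse \<open>\<psi>\<close>) straightens \<open>S\<close> to a
  \<open>k\<close>-dimensional linear subspace.
\<close>

definition C2_submanifold :: "nat \<Rightarrow> 'a::euclidean_space set \<Rightarrow> bool" where
  "C2_submanifold k S \<longleftrightarrow>
    (\<forall>p\<in>S. \<exists>W V L (\<phi> :: 'a \<Rightarrow> 'a) \<psi>.
      open W \<and> p \<in> W \<and> open V \<and>
      homeomorphism W V \<phi> \<psi> \<and> C2_on \<phi> W \<and> C2_on \<psi> V \<and>
      subspace L \<and> dim L = k \<and>
      \<phi> ` (S \<inter> W) = L \<inter> V)"

text \<open>The velocities at \<open>p\<close> of the $C^1$ curves that run in \<open>S\<close> and pass through \<open>p\<close> at time \<open>0\<close>.\<close>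

definition tangent_space :: "'a::euclidean_space set \<Rightarrow> 'a \<Rightarrow> 'a set" where
  "tangent_space S p =
    {w. \<exists>\<epsilon>>0. \<exists>\<gamma> \<gamma>'.
      (\<forall>t\<in>{-\<epsilon><..<\<epsilon>}. \<gamma> t \<in> S \<and> (\<gamma> has_vector_derivative \<gamma>' t) (at t)) \<and>
      continuous_on {-\<epsilon><..<\<epsilon>} \<gamma>' \<and> \<gamma> 0 = p \<and> \<gamma>' 0 = w}"

definition transversal_at :: "'a::euclidean_space set \<Rightarrow> 'a set \<Rightarrow> 'a \<Rightarrow> bool" where
  "transversal_at A B p \<longleftrightarrow>
    p \<in> A \<inter> B \<and>
    {a + b | a b. a \<in> tangent_space A p \<and> b \<in> tangent_space B p} = UNIV"

section \<open>The RRR flow\<close>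

text \<open>
  The metric projection onto \<open>S\<close> is \<^const>\<open>closest_point\<close>. Where the nearest point of a closed
  set is not unique, this is an arbitrary but fixed choice among the nearest points; near
  a transversal intersection point of two $C^2$ submanifolds the nearest points are unique.
\<close>

definition reflection :: "'a::euclidean_space set \<Rightarrow> 'a \<Rightarrow> 'a" where
  "reflection S x = 2 *\<^sub>R closest_point S x - x"

definition rrr_field :: "'a::euclidean_space set \<Rightarrow> 'a set \<Rightarrow> 'a \<Rightarrow> 'a" where
  "rrr_field A B x = closest_point B (reflection A x) - closest_point A x"

text \<open>Forward solutions; the values of \<open>x\<close> at negative times are irrelevant.\<close>

definition rrr_solution :: "'a::euclidean_space set \<Rightarrow> 'a set \<Rightarrow> (real \<Rightarrow> 'a) \<Rightarrow> bool" where
  "rrr_solution A B x \<longleftrightarrow>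
    (\<forall>t\<ge>0. (x has_vector_derivative rrr_field A B (x t)) (at t within {0..}))"

text \<open>
  The hitting time is a function of the trajectory \<open>x\<close>, so that no uniqueness of solutions is built
  into it. The infimum is taken in the extended reals, where \<open>Inf {} = \<infinity>\<close>.
\<close>

definition hitting_time ::
    "'a::euclidean_space set \<Rightarrow> 'a set \<Rightarrow> real \<Rightarrow> (real \<Rightarrow> 'a) \<Rightarrow> ereal" where
  "hitting_time A B \<delta> x = Inf (ereal ` {t. 0 \<le> t \<and> norm (rrr_field A B (x t)) \<le> \<delta>})"

end

theory Submission
  imports Defs
begin

text \<open>
  The nearest-point map of a \<open>C\<^sup>2\<close> submanifold is strictly differentiable at each point \<open>p\<close> of the
  submanifold, with derivative the orthogonal projector onto the tangent space: if \<open>a\<^sub>1\<close>, \<open>a\<^sub>2\<close> are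
  nearest to \<open>x\<^sub>1\<close>, \<open>x\<^sub>2\<close>, then \<open>a\<^sub>1 - a\<^sub>2\<close> is almost tangent at \<open>p\<close>, and the difference of the residuals
  \<open>x\<^sub>i - a\<^sub>i\<close>, which are normal at \<open>a\<^sub>i\<close>, is almost normal at \<open>p\<close> because the tangent spaces vary in a
  Lipschitz way. This needs neither the implicit function theorem nor uniqueness of nearest points.

  Hence the RRR field \<open>v\<close> has a strict derivative \<open>J = (R\<^sub>B R\<^sub>A - Id) / 2\<close> at the intersection point,
  where \<open>R\<^sub>A\<close>, \<open>R\<^sub>B\<close> are the reflections in the tangent spaces, and \<open>\<langle>z, J z\<rangle> = - \<parallel>J z\<parallel>\<^sup>2\<close>. The field is a
  difference of two residuals, almost normal to \<open>A\<close> and to \<open>B\<close>, and by transversality \<open>J\<close> is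
  injective on differences of normals; so \<open>\<parallel>J (v x)\<parallel> \<ge> m \<parallel>v x\<parallel>\<close>, and \<open>\<parallel>v\<parallel>\<close> decays exponentially
  along trajectories. The length of a trajectory is then at most a multiple of \<open>\<parallel>v (x 0)\<parallel>\<close>, which
  keeps it in the neighbourhood.
\<close>

section \<open>Strict differentiability\<close>

text \<open>Both points vary, so \<open>f - F\<close> has arbitrarily small Lipschitz constant near
  \<open>p\<close>. Such an estimate compares values of the field at two points of a trajectory and
  obeys the chain rule, without derivatives at points other than \<open>p\<close>.\<close>

definition has_strict_derivative ::
    "('a::real_normed_vector \<Rightarrow> 'b::real_normed_vector) \<Rightarrow> ('a \<Rightarrow> 'b) \<Rightarrow> 'a \<Rightarrow> bool" where
  "has_strict_derivative f F p \<longleftrightarrow> bounded_linear F \<and>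
    (\<forall>e>0. \<exists>r>0. \<forall>x\<in>ball p r. \<forall>y\<in>ball p r. norm (f x - f y - F (x - y)) \<le> e * norm (x - y))"

lemma has_strict_derivativeI:
  assumes "bounded_linear F"
    and "\<And>e. e > 0 \<Longrightarrow>
      \<exists>r>0. \<forall>x\<in>ball p r. \<forall>y\<in>ball p r. norm (f x - f y - F (x - y)) \<le> e * norm (x - y)"
  shows "has_strict_derivative f F p"
  using assms unfolding has_strict_derivative_def by blast

lemma has_strict_derivativeE:
  assumes "has_strict_derivative f F p" "e > 0"
  obtains r where "r > 0"
    "\<And>x y. x \<in> ball p r \<Longrightarrow> y \<in> ball p r \<Longrightarrow> norm (f x - f y - F (x - y)) \<le> e * norm (x - y)"
  using assms unfolding has_strict_derivative_def by blast

lemma has_strict_derivative_bounded_linear: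
  "has_strict_derivative f F p \<Longrightarrow> bounded_linear F"
  unfolding has_strict_derivative_def by blast

lemma has_strict_derivative_lipschitz:
  assumes f: "has_strict_derivative f F p"
  obtains K r where "K > 0" "r > 0"
    "\<And>x y. x \<in> ball p r \<Longrightarrow> y \<in> ball p r \<Longrightarrow> norm (f x - f y) \<le> K * norm (x - y)"
    "\<And>h. norm (F h) \<le> K * norm h"
proof -
  obtain r where r: "r > 0"
    "\<And>x y. x \<in> ball p r \<Longrightarrow> y \<in> ball p r \<Longrightarrow> norm (f x - f y - F (x - y)) \<le> 1 * norm (x - y)"
    using has_strict_derivativeE[OF f zero_less_one] by metis
  obtain K where K: "K > 0" "\<And>h. norm (F h) \<le> norm h * K"
    using bounded_linear.pos_bounded[OF has_strict_derivative_bounded_linear[OF f]] by blast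
  show ?thesis
  proof (rule that[of "K + 1" r])
    fix x y assume xy: "x \<in> ball p r" "y \<in> ball p r"
    have "norm (f x - f y) \<le> norm (f x - f y - F (x - y)) + norm (F (x - y))"
      using norm_triangle_sub[of "f x - f y" "F (x - y)"] by simp
    also have "\<dots> \<le> (K + 1) * norm (x - y)"
      using r(2)[OF xy] K(2)[of "x - y"] by (simp add: algebra_simps)
    finally show "norm (f x - f y) \<le> (K + 1) * norm (x - y)" .
  next
    fix h show "norm (F h) \<le> (K + 1) * norm h"
      using K(2)[of h] by (simp add: algebra_simps add_increasing)
  qed (use K r in auto)
qed

lemma has_strict_derivative_linear:
  assumes "bounded_linear F"
  shows "has_strict_derivative F F p"
  by (rule has_strict_derivativeI[OF assms])
    (auto simp: linear_diff[OF bounded_linear.linear[OF assms]] intro: exI[of _ 1])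

lemma has_strict_derivative_diff:
  assumes f: "has_strict_derivative f F p" and g: "has_strict_derivative g G p"
  shows "has_strict_derivative (\<lambda>x. f x - g x) (\<lambda>x. F x - G x) p"
proof (rule has_strict_derivativeI)
  show "bounded_linear (\<lambda>x. F x - G x)"
    by (intro bounded_linear_sub has_strict_derivative_bounded_linear[OF f]
        has_strict_derivative_bounded_linear[OF g])
  fix e :: real assume "e > 0"
  then have e: "e / 2 > 0" by simp
  obtain r where r: "r > 0"
    "\<And>x y. x \<in> ball p r \<Longrightarrow> y \<in> ball p r \<Longrightarrow> norm (f x - f y - F (x - y)) \<le> e / 2 * norm (x - y)"
    using has_strict_derivativeE[OF f e] by metis
  obtain s where s: "s > 0"
    "\<And>x y. x \<in> ball p s \<Longrightarrow> y \<in> ball p s \<Longrightarrow> norm (g x - g y - G (x - y)) \<le> e / 2 * norm (x - y)"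
    using has_strict_derivativeE[OF g e] by metis
  have "norm (f x - g x - (f y - g y) - (F (x - y) - G (x - y))) \<le> e * norm (x - y)"
    if "x \<in> ball p (min r s)" "y \<in> ball p (min r s)" for x y
  proof -
    have "norm (f x - g x - (f y - g y) - (F (x - y) - G (x - y)))
        = norm ((f x - f y - F (x - y)) - (g x - g y - G (x - y)))"
      by (simp add: algebra_simps)
    also have "\<dots> \<le> e / 2 * norm (x - y) + e / 2 * norm (x - y)"
      using that by (intro norm_triangle_le_diff add_mono r s) auto
    finally show ?thesis by simp
  qed
  then show "\<exists>r>0. \<forall>x\<in>ball p r. \<forall>y\<in>ball p r.
      norm (f x - g x - (f y - g y) - (F (x - y) - G (x - y))) \<le> e * norm (x - y)"
    using r(1) s(1) by (intro exI[of _ "min r s"]) auto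
qed

lemma has_strict_derivative_compose:
  assumes f: "has_strict_derivative f F p" and g: "has_strict_derivative g G (f p)"
  shows "has_strict_derivative (\<lambda>x. g (f x)) (\<lambda>h. G (F h)) p"
proof (rule has_strict_derivativeI)
  show "bounded_linear (\<lambda>h. G (F h))"
    by (intro bounded_linear_compose[OF has_strict_derivative_bounded_linear[OF g]]
        has_strict_derivative_bounded_linear[OF f])
  obtain K r where K: "K > 0" "r > 0"
    "\<And>x y. x \<in> ball p r \<Longrightarrow> y \<in> ball p r \<Longrightarrow> norm (f x - f y) \<le> K * norm (x - y)"
    using has_strict_derivative_lipschitz[OF f] by metis
  obtain C where C: "C > 0" "\<And>h. norm (G h) \<le> norm h * C"
    using bounded_linear.pos_bounded[OF has_strict_derivative_bounded_linear[OF g]] by blast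
  fix e :: real assume "e > 0"
  then have e1: "e / (2 * K) > 0" and e2: "e / (2 * C) > 0" using K C by auto
  obtain s where s: "s > 0"
    "\<And>x y. x \<in> ball (f p) s \<Longrightarrow> y \<in> ball (f p) s \<Longrightarrow>
      norm (g x - g y - G (x - y)) \<le> e / (2 * K) * norm (x - y)"
    using has_strict_derivativeE[OF g e1] by metis
  obtain q where q: "q > 0"
    "\<And>x y. x \<in> ball p q \<Longrightarrow> y \<in> ball p q \<Longrightarrow> norm (f x - f y - F (x - y)) \<le> e / (2 * C) * norm (x - y)"
    using has_strict_derivativeE[OF f e2] by metis
  define d where "d = Min {r, q, s / K}"
  have d: "d > 0" "d \<le> r" "d \<le> q" "d \<le> s / K"
    using K(1,2) s(1) q(1) by (auto simp: d_def)
  have fb: "f x \<in> ball (f p) s" if "x \<in> ball p d" for x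
  proof -
    have "norm (f p - f x) \<le> K * norm (p - x)" using that d K(2) by (intro K(3)) auto
    also have "\<dots> < K * d" using that K(1) by (simp add: dist_norm)
    also have "\<dots> \<le> s" using d(4) K(1) by (simp add: field_simps)
    finally show ?thesis by (simp add: dist_norm)
  qed
  have "norm (g (f x) - g (f y) - G (F (x - y))) \<le> e * norm (x - y)"
    if x: "x \<in> ball p d" and y: "y \<in> ball p d" for x y
  proof -
    interpret G: bounded_linear G by (rule has_strict_derivative_bounded_linear[OF g])
    have "norm (g (f x) - g (f y) - G (F (x - y)))
        = norm ((g (f x) - g (f y) - G (f x - f y)) + G (f x - f y - F (x - y)))"
      by (simp add: G.diff)
    also have "\<dots> \<le> e / (2 * K) * norm (f x - f y) + norm (f x - f y - F (x - y)) * C"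
      by (intro norm_triangle_le add_mono s(2) C(2) fb x y)
    also have "\<dots> \<le> e / (2 * K) * (K * norm (x - y)) + (e / (2 * C) * norm (x - y)) * C"
      using x y d K C \<open>e > 0\<close> by (intro add_mono mult_left_mono mult_right_mono K(3) q(2)) auto
    also have "\<dots> = e * norm (x - y)" using K C by (simp add: field_simps)
    finally show ?thesis .
  qed
  then show "\<exists>r>0. \<forall>x\<in>ball p r. \<forall>y\<in>ball p r.
      norm (g (f x) - g (f y) - G (F (x - y))) \<le> e * norm (x - y)"
    using d(1) by blast
qed

text \<open>\<open>f - f' p\<close> has derivative \<open>f' z - f' p\<close> at \<open>z\<close>,
  which is small near \<open>p\<close> by continuity, so the mean value inequality makes it
  Lipschitz with a small constant.\<close>

lemma C1_has_strict_derivative: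
  fixes f' :: "'a::real_normed_vector \<Rightarrow> 'a \<Rightarrow>\<^sub>L 'b::real_normed_vector"
  assumes W: "open W" "p \<in> W"
    and f: "\<And>x. x \<in> W \<Longrightarrow> (f has_derivative blinfun_apply (f' x)) (at x)"
    and cont: "isCont f' p"
  shows "has_strict_derivative f (blinfun_apply (f' p)) p"
proof (rule has_strict_derivativeI)
  show "bounded_linear (blinfun_apply (f' p))" by (rule blinfun.bounded_linear_right)
  fix e :: real assume "e > 0"
  then obtain d where d: "d > 0" "\<And>x. dist x p < d \<Longrightarrow> dist (f' x) (f' p) < e"
    using cont unfolding continuous_at_eps_delta by (metis dist_commute)
  obtain r where r: "r > 0" "ball p r \<subseteq> W" using W openE by blast
  have "norm (f x - f y - f' p (x - y)) \<le> e * norm (x - y)"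
    if x: "x \<in> ball p (min d r)" and y: "y \<in> ball p (min d r)" for x y
  proof -
    have "norm ((f x - f' p x) - (f y - f' p y)) \<le> e * norm (x - y)"
    proof (rule differentiable_bound[OF convex_ball _ _ x y])
      fix z assume z: "z \<in> ball p (min d r)"
      then have "((\<lambda>x. f x - f' p x) has_derivative (\<lambda>h. f' z h - f' p h)) (at z)"
        using r(2) by (intro has_derivative_diff f bounded_linear_imp_has_derivative
            blinfun.bounded_linear_right) auto
      then show "((\<lambda>x. f x - f' p x) has_derivative blinfun_apply (f' z - f' p))
          (at z within ball p (min d r))"
        by (simp add: minus_blinfun.rep_eq[symmetric] has_derivative_at_withinI blinfun.diff_left)
      show "onorm (blinfun_apply (f' z - f' p)) \<le> e"
        using d(2)[of z] z by (simp add: norm_blinfun.rep_eq[symmetric] dist_norm norm_minus_commute)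
    qed
    then show ?thesis by (simp add: blinfun.diff_right algebra_simps)
  qed
  then show "\<exists>r>0. \<forall>x\<in>ball p r. \<forall>y\<in>ball p r. norm (f x - f y - f' p (x - y)) \<le> e * norm (x - y)"
    using d(1) r(1) by (intro exI[of _ "min d r"]) auto
qed

section \<open>Orthogonal projectors\<close>

definition orthogonal_projector :: "'a::euclidean_space set \<Rightarrow> ('a \<Rightarrow> 'a) \<Rightarrow> bool" where
  "orthogonal_projector T P \<longleftrightarrow> linear P \<and> (\<forall>x. P x \<in> T) \<and> (\<forall>x\<in>T. P x = x) \<and>
    (\<forall>x y. P x \<bullet> y = x \<bullet> P y)"

lemma orthogonal_projector_exists:
  fixes T :: "'a::euclidean_space set"
  assumes "subspace T"
  obtains P where "orthogonal_projector T P"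
proof -
  obtain B where B: "B \<subseteq> T" "pairwise orthogonal B" "\<And>x. x \<in> B \<Longrightarrow> norm x = 1"
      "independent B" "span B = T"
    using orthonormal_basis_subspace[OF assms] by metis
  have fin: "finite B" using B(4) by (rule independent_imp_finite)
  define P where "P x = (\<Sum>b\<in>B. (x \<bullet> b) *\<^sub>R b)" for x
  have lin: "linear P"
    unfolding P_def by (intro linearI)
      (simp_all add: inner_add_left scaleR_add_left sum.distrib scaleR_sum_right)
  have Pb: "P b = b" if "b \<in> B" for b
  proof -
    have "P b = (\<Sum>c\<in>B. if c = b then b else 0)"
      unfolding P_def using B(2,3) that
      by (intro sum.cong refl) (auto simp: pairwise_def orthogonal_def norm_eq_1)
    then show ?thesis using fin that by simp
  qed
  have "P x = x" if "x \<in> T" for x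
    using that unfolding B(5)[symmetric]
    by (induction rule: span_induct_alt)
      (simp_all add: linear_0[OF lin] linear_add[OF lin] linear_scale[OF lin] Pb)
  moreover have "P x \<in> T" for x
    unfolding P_def using B(1) assms by (intro subspace_sum subspace_scale) auto
  moreover have "P x \<bullet> y = x \<bullet> P y" for x y
    unfolding P_def by (simp add: inner_sum_left inner_sum_right inner_commute mult.commute)
  ultimately show thesis using that lin unfolding orthogonal_projector_def by blast
qed

lemma orthogonal_projectorD:
  assumes "orthogonal_projector T P"
  shows "linear P" "bounded_linear P" "P x \<in> T" "x \<in> T \<Longrightarrow> P x = x" "P (P x) = P x"
    "P x \<bullet> y = x \<bullet> P y"
  using assms unfolding orthogonal_projector_def
  by (auto simp: linear_conv_bounded_linear[symmetric])

lemma orthogonal_projector_pythagoras: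
  assumes "orthogonal_projector T P"
  shows "(norm x)\<^sup>2 = (norm (P x))\<^sup>2 + (norm (x - P x))\<^sup>2"
proof -
  note P = orthogonal_projectorD[OF assms]
  have "P x \<bullet> P x = x \<bullet> P x" using P(5,6) by metis
  then show ?thesis
    by (simp add: power2_norm_eq_inner inner_diff_left inner_diff_right inner_commute)
qed

lemma orthogonal_projector_norm_le:
  assumes "orthogonal_projector T P"
  shows "norm (P x) \<le> norm x" "norm (x - P x) \<le> norm x"
  using orthogonal_projector_pythagoras[OF assms, of x]
  by (simp_all add: norm_le_square power2_norm_eq_inner[symmetric])

section \<open>The nearest-point map of a submanifold\<close>

text \<open>Near \<open>p\<close> continuity bounds \<open>f''\<close> by
  \<open>norm (f'' p) + 1\<close>, a Lipschitz constant for \<open>f'\<close>. For an inverse chart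
  this says that the tangent spaces vary in a Lipschitz way.\<close>

lemma C2_on_derivative_lipschitz:
  fixes f :: "'a::real_normed_vector \<Rightarrow> 'b::real_normed_vector"
  assumes "C2_on f W" "open W" "p \<in> W"
  obtains f' :: "'a \<Rightarrow> 'a \<Rightarrow>\<^sub>L 'b" and M r where
    "\<And>x. x \<in> W \<Longrightarrow> (f has_derivative blinfun_apply (f' x)) (at x)" "isCont f' p"
    "M > 0" "r > 0" "\<And>x y. x \<in> ball p r \<Longrightarrow> y \<in> ball p r \<Longrightarrow> norm (f' x - f' y) \<le> M * norm (x - y)"
proof -
  obtain f' and f'' :: "'a \<Rightarrow> 'a \<Rightarrow>\<^sub>L ('a \<Rightarrow>\<^sub>L 'b)" where
    f': "\<And>x. x \<in> W \<Longrightarrow> (f has_derivative blinfun_apply (f' x)) (at x)" and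
    f'': "\<And>x. x \<in> W \<Longrightarrow> (f' has_derivative blinfun_apply (f'' x)) (at x)" and
    cont: "continuous_on W f''"
    using assms(1) unfolding C2_on_def by metis
  have "isCont f'' p" using cont assms by (simp add: continuous_on_eq_continuous_at)
  then obtain d where d: "d > 0" "\<And>x. dist x p < d \<Longrightarrow> dist (f'' x) (f'' p) < 1"
    unfolding continuous_at_eps_delta using zero_less_one by blast
  obtain r where r: "r > 0" "ball p r \<subseteq> W" using openE[OF assms(2,3)] by metis
  have lip: "norm (f' x - f' y) \<le> (norm (f'' p) + 1) * norm (x - y)"
    if x: "x \<in> ball p (min d r)" and y: "y \<in> ball p (min d r)" for x y
  proof (rule differentiable_bound[where f = f' and f' = "\<lambda>z. blinfun_apply (f'' z)", OF convex_ball _ _ x y])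
    fix z assume z: "z \<in> ball p (min d r)"
    then show "(f' has_derivative blinfun_apply (f'' z)) (at z within ball p (min d r))"
      using r(2) by (intro has_derivative_at_withinI[OF f'']) auto
    have "norm (f'' z) \<le> norm (f'' p) + norm (f'' z - f'' p)"
      by (rule norm_triangle_sub)
    also have "\<dots> \<le> norm (f'' p) + 1"
      using d(2)[of z] z by (simp add: dist_norm norm_minus_commute)
    finally show "onorm (blinfun_apply (f'' z)) \<le> norm (f'' p) + 1"
      by (simp add: norm_blinfun.rep_eq)
  qed
  have "isCont f' p" by (rule has_derivative_continuous[OF f''[OF assms(3)]])
  moreover have "norm (f'' p) + 1 > 0" by (simp add: add_nonneg_pos)
  moreover have "min d r > 0" using d r by simp
  ultimately show thesis using that f' lip by blast
qed

text \<open>First-order condition at a minimum: along the chart line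
  \<open>u + s *\<^sub>R w\<close> the squared distance to \<open>x\<close> is least at
  \<open>s = 0\<close>, where its derivative is
  \<open>- 2 * ((x - \<psi> u) \<bullet> D w)\<close>.\<close>

lemma nearest_point_residual_normal:
  fixes \<psi> :: "'a::euclidean_space \<Rightarrow> 'b::euclidean_space"
  assumes "closed S" "subspace L" "open V" "u \<in> L \<inter> V" "\<psi> ` (L \<inter> V) \<subseteq> S"
    and D: "(\<psi> has_derivative D) (at u)" and u: "\<psi> u = closest_point S x" and "w \<in> L"
  shows "(x - \<psi> u) \<bullet> D w = 0"
proof -
  define g where "g s = (x - \<psi> (u + s *\<^sub>R w)) \<bullet> (x - \<psi> (u + s *\<^sub>R w))" for s :: real
  obtain d where d: "d > 0" "ball u d \<subseteq> V" using openE[OF assms(3)] assms(4) by (metis IntD2)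
  have lin: "((\<lambda>s::real. u + s *\<^sub>R w) has_derivative (\<lambda>s. s *\<^sub>R w)) (at 0)"
    by (auto intro!: derivative_eq_intros)
  have "((\<lambda>s::real. \<psi> (u + s *\<^sub>R w)) has_derivative (\<lambda>s. D (s *\<^sub>R w))) (at 0)"
    by (rule has_derivative_compose[OF lin]) (simp add: D)
  then have "((\<lambda>s::real. x - \<psi> (u + s *\<^sub>R w)) has_derivative (\<lambda>s. - D (s *\<^sub>R w))) (at 0)"
    by (auto intro!: derivative_eq_intros)
  then have "(g has_derivative (\<lambda>s. (x - \<psi> u) \<bullet> (- D (s *\<^sub>R w)) + (- D (s *\<^sub>R w)) \<bullet> (x - \<psi> u))) (at 0)"
    unfolding g_def using has_derivative_inner by fastforce
  then have "(g has_real_derivative - 2 * ((x - \<psi> u) \<bullet> D w)) (at 0)"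
    by (rule has_derivative_imp_has_field_derivative)
      (simp add: linear_scale[OF has_derivative_linear[OF D]] inner_commute)
  \<comment> \<open>For \<open>s\<close> below this bound the chart line stays in \<open>V\<close>;
    the \<open>+ 1\<close> covers \<open>w = 0\<close>.\<close>
  moreover have "d / (norm w + 1) > 0" using d(1) by (simp add: add_nonneg_pos)
  moreover have "g 0 \<le> g s" if "\<bar>0 - s\<bar> < d / (norm w + 1)" for s
  proof -
    have "norm (s *\<^sub>R w) \<le> \<bar>s\<bar> * (norm w + 1)" by (simp add: mult_left_mono)
    also have "\<dots> < d" using that by (simp add: pos_less_divide_eq add_nonneg_pos)
    finally have "u + s *\<^sub>R w \<in> V" using d(2) by (auto simp: dist_norm)
    moreover have "u + s *\<^sub>R w \<in> L" using assms by (auto intro: subspace_add subspace_scale)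
    ultimately have "\<psi> (u + s *\<^sub>R w) \<in> S" using assms by auto
    then have "dist x (\<psi> u) \<le> dist x (\<psi> (u + s *\<^sub>R w))"
      unfolding u by (rule closest_point_le[OF assms(1)])
    then show ?thesis by (simp add: g_def dist_norm norm_le)
  qed
  ultimately have "- 2 * ((x - \<psi> u) \<bullet> D w) = 0" by (intro DERIV_local_min) blast+
  then show ?thesis by simp
qed

text \<open>The chart turns a curve in \<open>S\<close> into a curve in \<open>L\<close>, so the
  velocity \<open>E w\<close> lies in \<open>L\<close>; and \<open>D\<close> takes
  \<open>E w\<close> back to \<open>w\<close>, since
  \<open>\<psi> (\<phi> (\<gamma> t)) = \<gamma> t\<close> near \<open>0\<close>.\<close>

lemma tangent_space_chart:
  fixes S :: "'a::euclidean_space set" and \<phi> :: "'a \<Rightarrow> 'b::euclidean_space"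
  assumes "homeomorphism W V \<phi> \<psi>" "open W" "p \<in> S \<inter> W" "\<phi> ` (S \<inter> W) \<subseteq> L" "subspace L"
    and \<phi>: "(\<phi> has_derivative E) (at p)" and \<psi>: "(\<psi> has_derivative D) (at (\<phi> p))"
  shows "tangent_space S p \<subseteq> D ` L"
proof
  fix w assume "w \<in> tangent_space S p"
  then obtain \<epsilon> \<gamma> \<gamma>' where \<gamma>: "\<epsilon> > 0" "\<And>t. t \<in> {-\<epsilon><..<\<epsilon>} \<Longrightarrow> \<gamma> t \<in> S"
    "\<And>t. t \<in> {-\<epsilon><..<\<epsilon>} \<Longrightarrow> (\<gamma> has_vector_derivative \<gamma>' t) (at t)" "\<gamma> 0 = p" "\<gamma>' 0 = w"
    unfolding tangent_space_def by blast
  have d\<gamma>: "(\<gamma> has_vector_derivative w) (at 0)" using \<gamma>(1,3,5) by auto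
  then have "isCont \<gamma> 0" by (rule has_vector_derivative_continuous)
  then have "\<forall>\<^sub>F t in at 0. \<gamma> t \<in> W"
    using \<gamma>(4) assms(2,3) by (intro topological_tendstoD) (auto simp: isCont_def)
  moreover have "\<forall>\<^sub>F t in at (0::real). t \<in> {-\<epsilon><..<\<epsilon>}"
    using \<gamma>(1) by (intro eventually_at_in_open') auto
  ultimately have ev: "\<forall>\<^sub>F t in at 0. \<gamma> t \<in> S \<inter> W" by eventually_elim (use \<gamma>(2) in auto)
  then have ev_nhds: "\<forall>\<^sub>F t in nhds 0. \<gamma> t \<in> S \<inter> W"
    using \<gamma>(4) assms(3) by (auto simp: eventually_at_filter elim!: eventually_mono)
  have E: "((\<lambda>t. \<phi> (\<gamma> t)) has_vector_derivative E w) (at 0)"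
    using vector_derivative_diff_chain_within[of \<gamma> w 0 UNIV \<phi> E] d\<gamma> \<phi> \<gamma>(4)
      has_derivative_at_withinI by (fastforce simp: o_def)
  have "E w \<in> L"
  proof -
    obtain P where P: "orthogonal_projector L P" using orthogonal_projector_exists[OF assms(5)] .
    \<comment> \<open>Projecting onto \<open>L\<close> does not change the curve near
      \<open>0\<close>, so it fixes the velocity as well.\<close>
    have "((\<lambda>t. P (\<phi> (\<gamma> t))) has_vector_derivative P (E w)) (at 0)"
      by (rule bounded_linear.has_vector_derivative[OF orthogonal_projectorD(2)[OF P] E])
    moreover have "\<forall>\<^sub>F t in nhds 0. P (\<phi> (\<gamma> t)) = \<phi> (\<gamma> t)"
      using ev_nhds
    proof eventually_elim
      case (elim t)
      then show ?case using assms(4) by (intro orthogonal_projectorD(4)[OF P]) auto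
    qed
    ultimately have "((\<lambda>t. \<phi> (\<gamma> t)) has_vector_derivative P (E w)) (at 0)"
      by (subst (asm) has_vector_derivative_cong_ev[where g = "\<lambda>t. \<phi> (\<gamma> t)"])
        (auto dest: eventually_nhds_x_imp_x)
    then have "E w = P (E w)" using E vector_derivative_unique_at by blast
    then show ?thesis using orthogonal_projectorD(3)[OF P] by metis
  qed
  moreover have "D (E w) = w"
  proof -
    have "((\<lambda>t. \<psi> (\<phi> (\<gamma> t))) has_vector_derivative D (E w)) (at 0)"
      using vector_derivative_diff_chain_within[of "\<lambda>t. \<phi> (\<gamma> t)" "E w" 0 UNIV \<psi> D] E \<psi> \<gamma>(4)
        has_derivative_at_withinI by (fastforce simp: o_def)
    moreover have "((\<lambda>t. \<psi> (\<phi> (\<gamma> t))) has_vector_derivative w) (at 0)"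
    proof -
      have "\<forall>\<^sub>F t in nhds 0. \<gamma> t = \<psi> (\<phi> (\<gamma> t))"
        using ev_nhds
      proof eventually_elim
        case (elim t)
        then show ?case using assms(1) by (auto simp: homeomorphism_def)
      qed
      then show ?thesis
        using d\<gamma> by (subst (asm) has_vector_derivative_cong_ev[where g = "\<lambda>t. \<psi> (\<phi> (\<gamma> t))"])
          (auto dest: eventually_nhds_x_imp_x)
    qed
    ultimately show ?thesis using vector_derivative_unique_at by blast
  qed
  ultimately show "w \<in> D ` L" by (metis imageI)
qed

text \<open>Here \<open>x\<close> and \<open>a\<close> stand for the differences of two points and
  of their nearest points. Since \<open>a - P x = (a - P a) - P (x - a)\<close>, the error is at
  most \<open>\<delta> * (3 * norm a + norm x)\<close>, and \<open>\<delta> \<le> 1/6\<close> lets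
  \<open>norm a\<close> be absorbed, giving \<open>norm a \<le> 3 * norm x\<close>.\<close>

lemma strict_estimate_from_tangent_normal_split:
  fixes a x :: "'a::euclidean_space"
  assumes P: "orthogonal_projector T P" and \<delta>: "0 < \<delta>" "\<delta> \<le> 1/6"
    and a: "norm (a - P a) \<le> \<delta> * norm a"
    and n: "norm (P (x - a)) \<le> \<delta> * (norm (x - a) + norm a)"
  shows "norm (a - P x) \<le> 10 * \<delta> * norm x"
proof -
  have lin: "P (x - a) = P x - P a" using orthogonal_projectorD(1)[OF P] by (rule linear_diff)
  have "norm (a - P x) = norm ((a - P a) - P (x - a))" by (simp add: lin)
  also have "\<dots> \<le> \<delta> * norm a + \<delta> * (norm (x - a) + norm a)"
    by (intro norm_triangle_le_diff add_mono a n)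
  also have "\<dots> \<le> \<delta> * norm a + \<delta> * ((norm x + norm a) + norm a)"
    using \<delta> by (intro add_left_mono mult_left_mono add_right_mono norm_triangle_ineq4) auto
  finally have *: "norm (a - P x) \<le> \<delta> * (3 * norm a + norm x)" by (simp add: algebra_simps)
  have "norm a \<le> norm (P x) + norm (a - P x)" by (rule norm_triangle_sub)
  also have "\<dots> \<le> norm x + 1/6 * (3 * norm a + norm x)"
    using \<delta> by (intro add_mono orthogonal_projector_norm_le(1)[OF P] order_trans[OF *] mult_right_mono) auto
  finally have "3 * norm a \<le> 7 * norm x" by (simp add: field_simps)
  then have "norm a \<le> 3 * norm x" using norm_ge_zero[of x] by linarith
  then have "\<delta> * (3 * norm a + norm x) \<le> \<delta> * (10 * norm x)" using \<delta> by (intro mult_left_mono) auto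
  then show ?thesis using * by simp
qed

lemma closest_point_has_strict_derivative:
  fixes S :: "'a::euclidean_space set"
  assumes "closed S" "C2_submanifold k S" "p \<in> S"
  obtains T P where "orthogonal_projector T P" "tangent_space S p \<subseteq> T"
    "has_strict_derivative (closest_point S) P p"
proof -
  obtain W V L and \<phi> \<psi> :: "'a \<Rightarrow> 'a" where W: "open W" "p \<in> W" "open V" and
    hom: "homeomorphism W V \<phi> \<psi>" and C2: "C2_on \<phi> W" "C2_on \<psi> V" and
    L: "subspace L" and im: "\<phi> ` (S \<inter> W) = L \<inter> V"
    using assms(2,3) unfolding C2_submanifold_def by metis
  have pV: "\<phi> p \<in> V" using hom W(2) by (auto simp: homeomorphism_def)
  obtain \<phi>' :: "'a \<Rightarrow> 'a \<Rightarrow>\<^sub>L 'a" where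
    \<phi>': "\<And>x. x \<in> W \<Longrightarrow> (\<phi> has_derivative blinfun_apply (\<phi>' x)) (at x)" "isCont \<phi>' p"
    using C2_on_derivative_lipschitz[OF C2(1) W(1,2)] by metis
  obtain \<psi>' :: "'a \<Rightarrow> 'a \<Rightarrow>\<^sub>L 'a" and M r2 where
    \<psi>': "\<And>x. x \<in> V \<Longrightarrow> (\<psi> has_derivative blinfun_apply (\<psi>' x)) (at x)" "isCont \<psi>' (\<phi> p)" and
    M: "M > 0" "r2 > 0"
      "\<And>x y. x \<in> ball (\<phi> p) r2 \<Longrightarrow> y \<in> ball (\<phi> p) r2 \<Longrightarrow> norm (\<psi>' x - \<psi>' y) \<le> M * norm (x - y)"
    using C2_on_derivative_lipschitz[OF C2(2) W(3) pV] by metis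
  define D where "D = blinfun_apply (\<psi>' (\<phi> p))"
  obtain K r1 where K: "K > 0" "r1 > 0"
    "\<And>x y. x \<in> ball p r1 \<Longrightarrow> y \<in> ball p r1 \<Longrightarrow> norm (\<phi> x - \<phi> y) \<le> K * norm (x - y)"
    "\<And>h. norm (\<phi>' p h) \<le> K * norm h"
    using has_strict_derivative_lipschitz[OF C1_has_strict_derivative[OF W(1,2) \<phi>'(1,2)]] by metis
  have str\<psi>: "has_strict_derivative \<psi> D (\<phi> p)"
    unfolding D_def by (rule C1_has_strict_derivative[OF W(3) pV \<psi>'(1,2)])
  have D: "(\<psi> has_derivative D) (at (\<phi> p))" unfolding D_def by (rule \<psi>'(1)[OF pV])
  have linD: "linear D" using D by (rule has_derivative_linear)
  \<comment> \<open>The chart derivative \<open>\<phi>' p\<close> is a left inverse of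
    \<open>D\<close>, so its bound \<open>K\<close> bounds \<open>D\<close> from below.\<close>
  have "((\<lambda>u. \<phi> (\<psi> u)) has_derivative (\<lambda>w. \<phi>' p (D w))) (at (\<phi> p))"
    using hom W(2) by (intro has_derivative_compose[OF D]) (simp add: homeomorphism_def \<phi>'(1))
  then have "((\<lambda>u. u) has_derivative (\<lambda>w. \<phi>' p (D w))) (at (\<phi> p))"
    by (rule has_derivative_transform_within_open[OF _ W(3) pV]) (use hom in \<open>simp add: homeomorphism_def\<close>)
  then have inv: "\<phi>' p (D w) = w" for w
    using has_derivative_unique[OF _ has_derivative_ident] by metis
  have D_below: "norm w \<le> K * norm (D w)" for w using K(4)[of "D w"] inv by simp
  obtain P where P: "orthogonal_projector (D ` L) P"
    using orthogonal_projector_exists[OF linear_subspace_image[OF linD L]] .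
  have LV: "\<psi> ` (L \<inter> V) \<subseteq> S" using hom unfolding im[symmetric] by (auto simp: homeomorphism_def)
  obtain r0 where r0: "r0 > 0" "ball p r0 \<subseteq> W" using openE[OF W(1,2)] by metis
  define a where "a = closest_point S"
  have aS: "a x \<in> S" for x unfolding a_def using assms by (intro closest_point_in_set) auto
  have ax: "dist x (a x) \<le> dist x p" for x unfolding a_def by (rule closest_point_le[OF assms(1,3)])
  have strict: "\<exists>r>0. \<forall>x\<in>ball p r. \<forall>y\<in>ball p r. norm (a x - a y - P (x - y)) \<le> e * norm (x - y)"
    if "e > 0" for e
  proof -
    define \<delta> where "\<delta> = min (1/6) (e / 10)"
    have \<delta>: "\<delta> > 0" "\<delta> \<le> 1/6" "10 * \<delta> \<le> e" using that by (auto simp: \<delta>_def)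
    have "\<delta> / K > 0" using \<delta> K by simp
    then obtain r3 where r3: "r3 > 0" "\<And>x y. x \<in> ball (\<phi> p) r3 \<Longrightarrow> y \<in> ball (\<phi> p) r3 \<Longrightarrow>
        norm (\<psi> x - \<psi> y - D (x - y)) \<le> \<delta> / K * norm (x - y)"
      using has_strict_derivativeE[OF str\<psi>] by metis
    \<comment> \<open>Nearest points of points in \<open>ball p r\<close> lie within
      \<open>2 * r\<close> of \<open>p\<close>, and their charts within \<open>2 * K * r\<close> of
      \<open>\<phi> p\<close>. The last entry makes the rotation of the tangent spaces over that
      distance cost at most \<open>\<delta>\<close>.\<close>
    define r where "r = Min {r0 / 2, r1 / 2, r2 / (2 * K), r3 / (2 * K), \<delta> / (2 * M * K\<^sup>2)}"
    have "r > 0" unfolding r_def using r0 K M r3 \<delta> by auto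
    have r: "2 * r \<le> r0" "2 * r \<le> r1" "2 * K * r \<le> r2" "2 * K * r \<le> r3" "2 * M * K\<^sup>2 * r \<le> \<delta>"
    proof -
      have "r \<le> r0 / 2" "r \<le> r1 / 2" "r \<le> r2 / (2 * K)" "r \<le> r3 / (2 * K)" "r \<le> \<delta> / (2 * M * K\<^sup>2)"
        by (simp_all add: r_def)
      then show "2 * r \<le> r0" "2 * r \<le> r1" "2 * K * r \<le> r2" "2 * K * r \<le> r3" "2 * M * K\<^sup>2 * r \<le> \<delta>"
        using K(1) M(1) by (simp_all add: field_simps)
    qed
    have near: "a x \<in> ball p (2 * r)" "norm (x - a x) \<le> r" if "x \<in> ball p r" for x
      using ax[of x] that dist_triangle[of p "a x" x] by (auto simp: dist_commute dist_norm)
    have aW: "a x \<in> W" if "x \<in> ball p r" for x using near(1)[OF that] r(1) r0(2) by auto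
    have u: "\<phi> (a x) \<in> L \<inter> V" "\<psi> (\<phi> (a x)) = a x" if "x \<in> ball p r" for x
      using aW[OF that] aS[of x] hom im by (auto simp: homeomorphism_def)
    have uK: "norm (\<phi> (a x) - \<phi> (a y)) \<le> K * norm (a x - a y)"
      if "x \<in> ball p r" "y \<in> ball p r" for x y
      using near(1)[OF that(1)] near(1)[OF that(2)] r(2) by (intro K(3)) auto
    have un: "norm (\<phi> p - \<phi> (a x)) < 2 * K * r" if "x \<in> ball p r" for x
    proof -
      have "norm (\<phi> p - \<phi> (a x)) \<le> K * norm (p - a x)"
        using near(1)[OF that] r(2) \<open>r > 0\<close> by (intro K(3)) auto
      also have "\<dots> < K * (2 * r)" using near(1)[OF that] K(1) by (simp add: dist_norm)
      finally show ?thesis by (simp add: mult_ac)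
    qed
    have normal: "(x - a x) \<bullet> \<psi>' (\<phi> (a x)) w = 0" if "x \<in> ball p r" "w \<in> L" for x w
      using nearest_point_residual_normal[OF assms(1) L W(3) u(1)[OF that(1)] LV \<psi>'(1) _ that(2), of x]
        u[OF that(1)] by (simp add: a_def)
    have main: "norm (a x - a y - P (x - y)) \<le> e * norm (x - y)"
      if x: "x \<in> ball p r" and y: "y \<in> ball p r" for x y
    proof -
      have ux: "\<phi> (a x) \<in> ball (\<phi> p) r2" "\<phi> (a x) \<in> ball (\<phi> p) r3"
        using un[OF x] r(3,4) by (auto simp: dist_norm)
      have uy: "\<phi> (a y) \<in> ball (\<phi> p) r2" "\<phi> (a y) \<in> ball (\<phi> p) r3"
        using un[OF y] r(3,4) by (auto simp: dist_norm)
      let ?n = "(x - a x) - (y - a y)"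
      have tan: "norm ((a x - a y) - P (a x - a y)) \<le> \<delta> * norm (a x - a y)"
      proof -
        \<comment> \<open>\<open>D d\<close> is tangent, so \<open>Id - P\<close> removes it and
          leaves the error of the linear approximation of \<open>\<psi>\<close>, at most
          \<open>\<delta> / K * norm d\<close>.\<close>
        define d where "d = \<phi> (a x) - \<phi> (a y)"
        have "d \<in> L" unfolding d_def using u(1)[OF x] u(1)[OF y] L by (intro subspace_diff) auto
        then have "P (D d) = D d" by (intro orthogonal_projectorD(4)[OF P]) auto
        then have "(a x - a y) - P (a x - a y) = (a x - a y - D d) - P (a x - a y - D d)"
          by (simp add: linear_diff[OF orthogonal_projectorD(1)[OF P]])
        then have "norm ((a x - a y) - P (a x - a y)) \<le> norm (a x - a y - D d)"
          using orthogonal_projector_norm_le(2)[OF P] by metis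
        also have "\<dots> \<le> \<delta> / K * norm d"
          using r3(2)[OF ux(2) uy(2)] u(2)[OF x] u(2)[OF y] by (simp add: d_def)
        also have "\<dots> \<le> \<delta> / K * (K * norm (a x - a y))"
          unfolding d_def using \<delta> K by (intro mult_left_mono uK x y) auto
        finally show ?thesis using K by simp
      qed
      have nor: "norm (P ?n) \<le> \<delta> * (norm ?n + norm (a x - a y))"
      proof -
        \<comment> \<open>\<open>P ?n\<close> is a tangent vector \<open>D w\<close>, so its squared
          norm is \<open>?n \<bullet> D w\<close>. The residuals are exactly normal to the images of
          \<open>w\<close> at their own base points; using these two relations leaves only
          differences of \<open>\<psi>'\<close>.\<close>
        obtain w where w: "w \<in> L" "P ?n = D w" using orthogonal_projectorD(3)[OF P] by blast
        have "P ?n \<bullet> P ?n = ?n \<bullet> D w"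
          using orthogonal_projectorD(5,6)[OF P] w(2) by metis
        also have "\<dots> = ?n \<bullet> (\<psi>' (\<phi> p) - \<psi>' (\<phi> (a x))) w
            + (y - a y) \<bullet> (\<psi>' (\<phi> (a y)) - \<psi>' (\<phi> (a x))) w"
          using normal[OF x w(1)] normal[OF y w(1)]
          by (simp add: D_def blinfun.diff_left inner_diff_left inner_diff_right)
        also have "\<dots> \<le> norm ?n * (M * (2 * K * r) * norm w)
            + r * (M * (K * norm (a x - a y)) * norm w)"
        proof (intro add_mono order_trans[OF norm_cauchy_schwarz] mult_mono)
          have "norm ((\<psi>' (\<phi> p) - \<psi>' (\<phi> (a x))) w) \<le> norm (\<psi>' (\<phi> p) - \<psi>' (\<phi> (a x))) * norm w"
            by (rule norm_blinfun)
          also have "\<dots> \<le> (M * (2 * K * r)) * norm w"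
            using un[OF x] M by (intro mult_right_mono order_trans[OF M(3)] ux mult_left_mono) auto
          finally show "norm ((\<psi>' (\<phi> p) - \<psi>' (\<phi> (a x))) w) \<le> M * (2 * K * r) * norm w" .
          have "norm ((\<psi>' (\<phi> (a y)) - \<psi>' (\<phi> (a x))) w)
              \<le> norm (\<psi>' (\<phi> (a y)) - \<psi>' (\<phi> (a x))) * norm w"
            by (rule norm_blinfun)
          also have "\<dots> \<le> (M * (K * norm (a x - a y))) * norm w"
            using uK[OF y x] M
            by (intro mult_right_mono order_trans[OF M(3)] ux uy mult_left_mono)
              (auto simp: norm_minus_commute)
          finally show "norm ((\<psi>' (\<phi> (a y)) - \<psi>' (\<phi> (a x))) w) \<le> M * (K * norm (a x - a y)) * norm w" .
        qed (use near(2)[OF y] \<open>r > 0\<close> in auto)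
        also have "\<dots> = (M * K * r * norm w) * (2 * norm ?n + norm (a x - a y))"
          by (simp add: algebra_simps)
        also have "\<dots> \<le> (M * K * r * norm w) * (2 * (norm ?n + norm (a x - a y)))"
          using M K \<open>r > 0\<close> by (intro mult_left_mono) auto
        also have "\<dots> = (2 * M * K * r * (norm ?n + norm (a x - a y))) * norm w"
          by (simp add: algebra_simps)
        \<comment> \<open>The lower bound for \<open>D\<close> turns \<open>norm w\<close> into
          \<open>K * norm (P ?n)\<close>, whose last factor cancels at the end.\<close>
        also have "\<dots> \<le> (2 * M * K * r * (norm ?n + norm (a x - a y))) * (K * norm (P ?n))"
          using M K \<open>r > 0\<close> D_below[of w] w(2) by (intro mult_left_mono mult_nonneg_nonneg) auto
        also have "\<dots> = (2 * M * K\<^sup>2 * r) * (norm ?n + norm (a x - a y)) * norm (P ?n)"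
          by (simp add: power2_eq_square algebra_simps)
        also have "\<dots> \<le> \<delta> * (norm ?n + norm (a x - a y)) * norm (P ?n)"
          by (intro mult_right_mono r(5)) auto
        finally have "norm (P ?n) * norm (P ?n) \<le> \<delta> * (norm ?n + norm (a x - a y)) * norm (P ?n)"
          by (metis norm_eq_sqrt_inner real_sqrt_mult_self abs_of_nonneg inner_ge_zero)
        then show ?thesis
          using \<delta>(1) by (cases "P ?n = 0") auto
      qed
      have eq: "x - y - (a x - a y) = ?n" by simp
      have "norm (a x - a y - P (x - y)) \<le> 10 * \<delta> * norm (x - y)"
        by (rule strict_estimate_from_tangent_normal_split[OF P \<delta>(1,2) tan]) (unfold eq, rule nor)
      also have "\<dots> \<le> e * norm (x - y)" using \<delta>(3) by (intro mult_right_mono) auto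
      finally show ?thesis .
    qed
    then show ?thesis using \<open>r > 0\<close> by blast
  qed
  have "tangent_space S p \<subseteq> D ` L"
    using assms(3) W(2) im by (intro tangent_space_chart[OF hom W(1) _ _ L \<phi>'(1) D]) auto
  moreover have "has_strict_derivative (closest_point S) P p"
    using strict unfolding a_def by (rule has_strict_derivativeI[OF orthogonal_projectorD(2)[OF P]])
  ultimately show thesis using that P by blast
qed

section \<open>Linearization of the RRR field\<close>

definition rrr_linear :: "('a::real_vector \<Rightarrow> 'a) \<Rightarrow> ('a \<Rightarrow> 'a) \<Rightarrow> 'a \<Rightarrow> 'a" where
  "rrr_linear P Q z = Q (2 *\<^sub>R P z - z) - P z"

lemma rrr_linear_bounded_linear:
  assumes "bounded_linear P" "bounded_linear Q"
  shows "bounded_linear (rrr_linear P Q)"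
  unfolding rrr_linear_def
  by (intro bounded_linear_sub bounded_linear_compose[OF assms(2)] assms(1)
      bounded_linear_const_scaleR bounded_linear_ident)

text \<open>
  \<open>rrr_linear P Q\<close> is \<open>(R\<^sub>Q R\<^sub>P - Id) / 2\<close> for the two reflections \<open>R = 2 P - Id\<close>, and an isometry
  \<open>O\<close> satisfies \<open>\<langle>z, (O - Id) z\<rangle> = - \<parallel>(O - Id) z\<parallel>\<^sup>2 / 2\<close>.
\<close>

lemma rrr_linear_dissipative:
  assumes P: "orthogonal_projector T P" and Q: "orthogonal_projector N Q"
  shows "z \<bullet> rrr_linear P Q z = - (norm (rrr_linear P Q z))\<^sup>2"
proof -
  define w where "w = P z"
  define q where "q = Q (2 *\<^sub>R w - z)"
  have "q \<bullet> q = q \<bullet> (2 *\<^sub>R w - z)" unfolding q_def using orthogonal_projectorD(5,6)[OF Q] by metis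
  moreover have "w \<bullet> w = w \<bullet> z" unfolding w_def using orthogonal_projectorD(5,6)[OF P] by metis
  ultimately have "z \<bullet> (q - w) = - ((q - w) \<bullet> (q - w))"
    by (simp add: inner_diff_left inner_diff_right inner_commute)
  then show ?thesis by (simp add: rrr_linear_def power2_norm_eq_inner q_def w_def)
qed

lemma rrr_linear_norm_le:
  assumes "orthogonal_projector T P" "orthogonal_projector N Q"
  shows "norm (rrr_linear P Q z) \<le> norm z"
proof -
  have "(norm (rrr_linear P Q z))\<^sup>2 = \<bar>z \<bullet> rrr_linear P Q z\<bar>"
    using rrr_linear_dissipative[OF assms] by simp
  also have "\<dots> \<le> norm z * norm (rrr_linear P Q z)" by (rule Cauchy_Schwarz_ineq2)
  finally show ?thesis by (cases "norm (rrr_linear P Q z) = 0") (simp_all add: power2_eq_square)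
qed

text \<open>The vanishing projections make \<open>n\<close> orthogonal to \<open>T\<close> and to
  \<open>N\<close>, hence to their sum, which contains \<open>n\<close>.\<close>

lemma common_normal_eq_0:
  assumes P: "orthogonal_projector T P" and Q: "orthogonal_projector N Q"
    and sum: "{a + b | a b. a \<in> T \<and> b \<in> N} = UNIV" and n: "P n = 0" "Q n = 0"
  shows "n = 0"
proof -
  obtain a b where ab: "n = a + b" "a \<in> T" "b \<in> N" using sum by blast
  have "n \<bullet> a = P n \<bullet> a" using orthogonal_projectorD(4,6)[OF P] ab(2) by metis
  moreover have "n \<bullet> b = Q n \<bullet> b" using orthogonal_projectorD(4,6)[OF Q] ab(3) by metis
  ultimately have "n \<bullet> n = 0" using n ab(1) by (metis inner_add_right inner_zero_left add_0)
  then show ?thesis by simp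
qed

text \<open>A zero \<open>z = \<alpha> - \<beta>\<close> of the linear field has
  \<open>P z = Q z = w\<close>; then \<open>z - w\<close> is normal to both spaces, so
  \<open>z = w\<close> lies in both. But \<open>z\<close> is a difference of normals, so
  \<open>z \<bullet> z = 0\<close>, and \<open>\<alpha> = \<beta>\<close> is a common
  normal.\<close>

lemma rrr_linear_injective_on_normals:
  assumes P: "orthogonal_projector T P" and Q: "orthogonal_projector N Q"
    and sum: "{a + b | a b. a \<in> T \<and> b \<in> N} = UNIV"
    and \<alpha>: "P \<alpha> = 0" and \<beta>: "Q \<beta> = 0" and J: "rrr_linear P Q (\<alpha> - \<beta>) = 0"
  shows "\<alpha> = 0 \<and> \<beta> = 0"
proof -
  note linP = orthogonal_projectorD(1)[OF P] and linQ = orthogonal_projectorD(1)[OF Q]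
  define z where "z = \<alpha> - \<beta>"
  define w where "w = P z"
  have Qw: "Q (2 *\<^sub>R w - z) = w" using J by (simp add: rrr_linear_def w_def z_def)
  have "Q w = w" using Qw orthogonal_projectorD(5)[OF Q] by metis
  moreover have "Q (2 *\<^sub>R w - z) = 2 *\<^sub>R Q w - Q z"
    by (simp only: linear_diff[OF linQ] linear_scale[OF linQ])
  ultimately have Qz: "Q z = w" using Qw by (simp add: scaleR_2)
  have "z - w = 0"
  proof (rule common_normal_eq_0[OF P Q sum])
    show "P (z - w) = 0" using orthogonal_projectorD(5)[OF P] by (simp add: w_def linear_diff[OF linP])
    show "Q (z - w) = 0" using Qz \<open>Q w = w\<close> by (simp add: linear_diff[OF linQ])
  qed
  then have z: "P z = z" "Q z = z" using Qz by (simp_all add: w_def)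
  have "z \<bullet> \<alpha> = z \<bullet> P \<alpha>" using orthogonal_projectorD(6)[OF P] z(1) by metis
  moreover have "z \<bullet> \<beta> = z \<bullet> Q \<beta>" using orthogonal_projectorD(6)[OF Q] z(2) by metis
  ultimately have "z \<bullet> z = 0" using \<alpha> \<beta> by (simp add: z_def inner_diff_right)
  then have "\<alpha> = \<beta>" by (simp add: z_def)
  then show ?thesis using common_normal_eq_0[OF P Q sum] \<alpha> \<beta> by metis
qed

text \<open>An injective linear map on a finite-dimensional space is bounded below. This applies to
  exact normals; almost normal vectors are reduced to their normal parts, up to an absorbable
  error.\<close>

lemma rrr_linear_coercive_near_normals:
  fixes P Q :: "'a::euclidean_space \<Rightarrow> 'a"
  assumes P: "orthogonal_projector T P" and Q: "orthogonal_projector N Q"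
    and sum: "{a + b | a b. a \<in> T \<and> b \<in> N} = UNIV"
  obtains m \<epsilon> where "m > 0" "\<epsilon> > 0"
    "\<And>\<alpha> \<beta>. norm (P \<alpha>) \<le> \<epsilon> * norm \<alpha> \<Longrightarrow> norm (Q \<beta>) \<le> \<epsilon> * norm \<beta> \<Longrightarrow>
      norm (rrr_linear P Q (\<alpha> - \<beta>)) \<ge> m * norm (\<alpha> - \<beta>)"
proof -
  note linP = orthogonal_projectorD(1)[OF P] and linQ = orthogonal_projectorD(1)[OF Q]
  define J where "J = rrr_linear P Q"
  have J: "bounded_linear J" unfolding J_def
    by (intro rrr_linear_bounded_linear orthogonal_projectorD(2)[OF P] orthogonal_projectorD(2)[OF Q])
  \<comment> \<open>Pairs, because the errors to be absorbed scale with \<open>norm \<alpha>\<close>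
    and \<open>norm \<beta>\<close>, not with \<open>norm (\<alpha> - \<beta>)\<close>; a lower
    bound by the norm of the pair controls both.\<close>
  define K where "K = {p. P (fst p) = 0 \<and> Q (snd p) = 0}"
  have K: "subspace K"
    unfolding K_def subspace_def
    by (auto simp: linear_0[OF linP] linear_0[OF linQ] linear_add[OF linP] linear_add[OF linQ]
        linear_scale[OF linP] linear_scale[OF linQ])
  have "bounded_linear (\<lambda>p. J (fst p - snd p))"
    by (intro bounded_linear_compose[OF J] bounded_linear_sub bounded_linear_fst bounded_linear_snd)
  moreover have "\<forall>p\<in>K. J (fst p - snd p) = 0 \<longrightarrow> p = 0"
  proof (intro ballI impI)
    fix p assume "p \<in> K" "J (fst p - snd p) = 0"
    then show "p = 0" using rrr_linear_injective_on_normals[OF P Q sum, of "fst p" "snd p"]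
      by (simp add: K_def J_def prod_eq_iff)
  qed
  ultimately obtain e where e: "e > 0" "\<And>p. p \<in> K \<Longrightarrow> norm (J (fst p - snd p)) \<ge> e * norm p"
    using injective_imp_isometric[OF closed_subspace[OF K] K] by blast
  \<comment> \<open>\<open>1/2\<close> makes each normal part at least half of its vector, so
    \<open>s \<le> 4 * norm p\<close>; \<open>e/8\<close> then costs half of the available
    \<open>e / 4 * s\<close>.\<close>
  define \<epsilon> where "\<epsilon> = min (1/2) (e/8)"
  have \<epsilon>: "\<epsilon> > 0" "\<epsilon> \<le> 1/2" "\<epsilon> \<le> e / 8" using e(1) by (auto simp: \<epsilon>_def)
  show thesis
  proof (rule that[of "e / 8" \<epsilon>])
    fix \<alpha> \<beta> assume \<alpha>: "norm (P \<alpha>) \<le> \<epsilon> * norm \<alpha>" and \<beta>: "norm (Q \<beta>) \<le> \<epsilon> * norm \<beta>"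
    define s where "s = norm \<alpha> + norm \<beta>"
    define p where "p = (\<alpha> - P \<alpha>, \<beta> - Q \<beta>)"
    have "s \<ge> 0" by (simp add: s_def)
    have "norm \<alpha> \<le> 2 * norm (\<alpha> - P \<alpha>)"
      using norm_triangle_sub[of \<alpha> "P \<alpha>"] \<alpha> mult_right_mono[OF \<epsilon>(2) norm_ge_zero[of \<alpha>]] by linarith
    moreover have "norm \<beta> \<le> 2 * norm (\<beta> - Q \<beta>)"
      using norm_triangle_sub[of \<beta> "Q \<beta>"] \<beta> mult_right_mono[OF \<epsilon>(2) norm_ge_zero[of \<beta>]] by linarith
    moreover have "norm (\<alpha> - P \<alpha>) \<le> norm p" "norm (\<beta> - Q \<beta>) \<le> norm p"
      using norm_fst_le[of "fst p" "snd p"] norm_snd_le[of "snd p" "fst p"] by (simp_all add: p_def)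
    ultimately have "s \<le> 4 * norm p" unfolding s_def by linarith
    then have "e * s \<le> 4 * (e * norm p)" using e(1) by simp
    have "p \<in> K"
      unfolding K_def p_def using orthogonal_projectorD(5)[OF P] orthogonal_projectorD(5)[OF Q]
      by (simp add: linear_diff[OF linP] linear_diff[OF linQ])
    then have "e * norm p \<le> norm (J (fst p - snd p))" by (rule e(2))
    also have "fst p - snd p = (\<alpha> - \<beta>) - (P \<alpha> - Q \<beta>)" by (simp add: p_def)
    also have "J \<dots> = J (\<alpha> - \<beta>) - J (P \<alpha> - Q \<beta>)" by (rule linear_diff[OF bounded_linear.linear[OF J]])
    also have "norm \<dots> \<le> norm (J (\<alpha> - \<beta>)) + norm (P \<alpha> - Q \<beta>)"
      unfolding J_def by (intro norm_triangle_le_diff add_left_mono rrr_linear_norm_le[OF P Q])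
    also have "norm (P \<alpha> - Q \<beta>) \<le> \<epsilon> * s"
      unfolding s_def distrib_left by (intro norm_triangle_le_diff add_mono \<alpha> \<beta>)
    also have "\<epsilon> * s \<le> e / 8 * s" using \<epsilon>(3) \<open>s \<ge> 0\<close> by (rule mult_right_mono)
    finally have "e / 8 * s \<le> norm (J (\<alpha> - \<beta>))" using \<open>e * s \<le> 4 * (e * norm p)\<close> by simp
    moreover have "e / 8 * norm (\<alpha> - \<beta>) \<le> e / 8 * s"
      unfolding s_def using e(1) by (intro mult_left_mono norm_triangle_ineq4) auto
    ultimately show "norm (rrr_linear P Q (\<alpha> - \<beta>)) \<ge> e / 8 * norm (\<alpha> - \<beta>)"
      by (simp add: J_def)
  qed (use e \<epsilon> in auto)
qed

section \<open>From exact normals to the residuals of the nearest-point maps\<close>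

lemma closest_point_near_center:
  assumes "closed S" "p \<in> S"
  shows "dist p (closest_point S x) \<le> 2 * dist p x"
  using closest_point_le[OF assms, of x] dist_triangle[of p "closest_point S x" x]
  by (simp add: dist_commute)

lemma reflection_near_center:
  assumes "closed S" "p \<in> S"
  shows "dist p (reflection S x) \<le> 5 * dist p x"
proof -
  have "norm (p - reflection S x) = norm (2 *\<^sub>R (p - closest_point S x) - (p - x))"
    by (simp add: reflection_def algebra_simps scaleR_2)
  also have "\<dots> \<le> 2 * norm (p - closest_point S x) + norm (p - x)"
    by (rule norm_triangle_le_diff) simp
  finally show ?thesis using closest_point_near_center[OF assms, of x] by (simp add: dist_norm)
qed

text \<open>The nearest point \<open>a\<close> of \<open>x\<close> is its own nearest point, so the
  strict derivative estimate for the pair \<open>x\<close>, \<open>a\<close> compares equal values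
  and only \<open>P (x - a)\<close> remains.\<close>

lemma residual_nearly_normal:
  assumes S: "closed S" "p \<in> S" and P: "has_strict_derivative (closest_point S) P p" and "\<epsilon> > 0"
  obtains r where "r > 0"
    "\<And>x. x \<in> ball p r \<Longrightarrow> norm (P (x - closest_point S x)) \<le> \<epsilon> * norm (x - closest_point S x)"
proof -
  obtain r where r: "r > 0" "\<And>x y. x \<in> ball p r \<Longrightarrow> y \<in> ball p r \<Longrightarrow>
      norm (closest_point S x - closest_point S y - P (x - y)) \<le> \<epsilon> * norm (x - y)"
    using has_strict_derivativeE[OF P \<open>\<epsilon> > 0\<close>] by metis
  show thesis
  proof (rule that[of "r / 2"])
    fix x assume x: "x \<in> ball p (r / 2)"
    have "closest_point S (closest_point S x) = closest_point S x"
      using S by (intro closest_point_self closest_point_in_set) auto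
    moreover have "closest_point S x \<in> ball p r"
      using closest_point_near_center[OF S, of x] x by simp
    moreover have "x \<in> ball p r" using x zero_le_dist[of p x] by (simp del: zero_le_dist)
    ultimately show "norm (P (x - closest_point S x)) \<le> \<epsilon> * norm (x - closest_point S x)"
      using r(2)[of x "closest_point S x"] by simp
  qed (use r in simp)
qed

lemma rrr_field_has_strict_derivative:
  assumes "p \<in> A" and P: "has_strict_derivative (closest_point A) P p"
    and Q: "has_strict_derivative (closest_point B) Q p"
  shows "has_strict_derivative (rrr_field A B) (rrr_linear P Q) p"
proof -
  have "has_strict_derivative (\<lambda>x. 2 *\<^sub>R closest_point A x) (\<lambda>h. 2 *\<^sub>R P h) p"
    by (rule has_strict_derivative_compose[OF P has_strict_derivative_linear[OF bounded_linear_scaleR_right]])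
  then have refl: "has_strict_derivative (\<lambda>x. 2 *\<^sub>R closest_point A x - x) (\<lambda>h. 2 *\<^sub>R P h - h) p"
    by (rule has_strict_derivative_diff[OF _ has_strict_derivative_linear[OF bounded_linear_ident]])
  have "2 *\<^sub>R closest_point A p - p = p" using \<open>p \<in> A\<close> by (simp add: closest_point_self scaleR_2)
  then have "has_strict_derivative (\<lambda>x. closest_point B (2 *\<^sub>R closest_point A x - x))
      (\<lambda>h. Q (2 *\<^sub>R P h - h)) p"
    using Q by (intro has_strict_derivative_compose[OF refl]) simp
  from has_strict_derivative_diff[OF this P]
  have "has_strict_derivative (\<lambda>x. closest_point B (2 *\<^sub>R closest_point A x - x) - closest_point A x)
      (\<lambda>h. Q (2 *\<^sub>R P h - h) - P h) p" .
  moreover have "rrr_field A B = (\<lambda>x. closest_point B (2 *\<^sub>R closest_point A x - x) - closest_point A x)"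
    by (simp add: fun_eq_iff rrr_field_def reflection_def)
  moreover have "rrr_linear P Q = (\<lambda>h. Q (2 *\<^sub>R P h - h) - P h)"
    by (simp add: fun_eq_iff rrr_linear_def)
  ultimately show ?thesis by simp
qed

text \<open>
  The field is the difference \<open>(a - x) - (y - b)\<close> of the two residuals, with \<open>a\<close> nearest to \<open>x\<close>
  in \<open>A\<close> and \<open>b\<close> nearest to \<open>y = 2 a - x\<close> in \<open>B\<close>; near \<open>p\<close> these are almost normal at \<open>p\<close>, so the
  field avoids the kernel of its linearization.
\<close>

lemma rrr_linear_coercive_on_field:
  fixes A B :: "'a::euclidean_space set"
  assumes "closed A" "closed B" "p \<in> A" "p \<in> B"
    and P: "orthogonal_projector T P" "has_strict_derivative (closest_point A) P p"
    and Q: "orthogonal_projector N Q" "has_strict_derivative (closest_point B) Q p"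
    and sum: "{a + b | a b. a \<in> T \<and> b \<in> N} = UNIV"
  obtains m r where "m > 0" "r > 0"
    "\<And>x. x \<in> ball p r \<Longrightarrow> m * norm (rrr_field A B x) \<le> norm (rrr_linear P Q (rrr_field A B x))"
proof -
  obtain m \<epsilon> where m: "m > 0" "\<epsilon> > 0"
    "\<And>\<alpha> \<beta>. norm (P \<alpha>) \<le> \<epsilon> * norm \<alpha> \<Longrightarrow> norm (Q \<beta>) \<le> \<epsilon> * norm \<beta> \<Longrightarrow>
      norm (rrr_linear P Q (\<alpha> - \<beta>)) \<ge> m * norm (\<alpha> - \<beta>)"
    using rrr_linear_coercive_near_normals[OF P(1) Q(1) sum] by metis
  obtain r where r: "r > 0"
    "\<And>x. x \<in> ball p r \<Longrightarrow> norm (P (x - closest_point A x)) \<le> \<epsilon> * norm (x - closest_point A x)"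
    using residual_nearly_normal[OF assms(1,3) P(2) m(2)] by metis
  obtain s where s: "s > 0"
    "\<And>x. x \<in> ball p s \<Longrightarrow> norm (Q (x - closest_point B x)) \<le> \<epsilon> * norm (x - closest_point B x)"
    using residual_nearly_normal[OF assms(2,4) Q(2) m(2)] by metis
  show thesis
  \<comment> \<open>Reflection in \<open>A\<close> enlarges the distance to \<open>p\<close> at most
    fivefold, so \<open>y\<close> lands in \<open>ball p s\<close>.\<close>
  proof (rule that[of m "min r (s / 5)"])
    fix x assume x: "x \<in> ball p (min r (s / 5))"
    define y where "y = reflection A x"
    have y: "y \<in> ball p s" using reflection_near_center[OF assms(1,3), of x] x by (simp add: y_def)
    have "P (- (x - closest_point A x)) = - P (x - closest_point A x)"
      by (rule linear_neg[OF orthogonal_projectorD(1)[OF P(1)]])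
    then have "norm (P (closest_point A x - x)) \<le> \<epsilon> * norm (closest_point A x - x)"
      using r(2)[of x] x by (simp add: norm_minus_commute)
    from m(3)[OF this s(2)[OF y]]
    show "m * norm (rrr_field A B x) \<le> norm (rrr_linear P Q (rrr_field A B x))"
      by (simp add: rrr_field_def y_def reflection_def scaleR_2 algebra_simps)
  qed (use m r s in auto)
qed

section \<open>Trajectories of Lipschitz fields\<close>

lemma integral_has_vector_derivative_atLeast:
  fixes h :: "real \<Rightarrow> 'a::banach"
  assumes "continuous_on UNIV h" "t \<ge> 0"
  shows "((\<lambda>u. integral {0..u} h) has_vector_derivative h t) (at t within {0..})"
proof -
  have "((\<lambda>u. integral {0..u} h) has_vector_derivative h t) (at t within {0..t + 1})"
    using assms by (intro integral_has_vector_derivative continuous_on_subset[OF assms(1)]) auto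
  moreover have "at t within {0..t + 1} = at t within {0..}"
    by (rule at_within_nhd[of t "{..<t + 1}"]) auto
  ultimately show ?thesis by simp
qed

text \<open>Comparison with the primitive \<open>D / c * exp (c * s)\<close> of the bound; the
  weight cancels its growth. The gained \<open>1 / c\<close> is what makes the Picard map
  contract.\<close>

lemma norm_integral_exp_bound:
  fixes h :: "real \<Rightarrow> 'a::banach"
  assumes h: "continuous_on UNIV h" and "c > 0" "D \<ge> 0" "t \<ge> 0"
    and bound: "\<And>s. s \<ge> 0 \<Longrightarrow> norm (h s) \<le> D * exp (c * s)"
  shows "norm (exp (- c * t) *\<^sub>R integral {0..t} h) \<le> D / c"
proof (cases "t = 0")
  case False
  define H where "H u = integral {0..u} h" for u
  have H: "(H has_vector_derivative h s) (at s within {0..})" if "s \<ge> 0" for s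
    unfolding H_def using integral_has_vector_derivative_atLeast[OF h that] .
  have "norm (H t - H 0) \<le> D / c * exp (c * t) - D / c * exp (c * 0)"
  proof (rule differentiable_bound_general[where f' = h and \<phi>' = "\<lambda>s. D * exp (c * s)"])
    show "continuous_on {0..t} H"
      by (rule continuous_on_vector_derivative, rule has_vector_derivative_within_subset[OF H]) auto
    fix s assume s: "0 < s" "s < t"
    show "(H has_vector_derivative h s) (at s)"
      using H[of s] s at_within_interior[of s "{0..}"] by simp
    show "((\<lambda>s. D / c * exp (c * s)) has_vector_derivative D * exp (c * s)) (at s)"
      using \<open>c > 0\<close> by (auto intro!: derivative_eq_intros simp: has_real_derivative_iff_has_vector_derivative[symmetric])
    show "norm (h s) \<le> D * exp (c * s)" using s by (intro bound) simp
  qed (use assms False in \<open>auto intro!: continuous_intros\<close>)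
  moreover have "D / c \<ge> 0" using assms by simp
  ultimately have "norm (H t) \<le> D / c * exp (c * t)" by (simp add: H_def)
  then have "exp (- c * t) * norm (H t) \<le> exp (- c * t) * (D / c * exp (c * t))"
    by (rule mult_left_mono) simp
  also have "\<dots> = D / c" by (simp add: exp_minus)
  finally show ?thesis by (simp add: H_def)
qed (use assms in simp)

text \<open>
  Picard iteration for \<open>y t = exp (- c t) (x t - x0)\<close>: in this weighted sup norm it is a
  contraction on the whole half-line once \<open>c\<close> exceeds the Lipschitz constant.
\<close>

lemma lipschitz_field_solution_exists:
  fixes f :: "'a::euclidean_space \<Rightarrow> 'a"
  assumes K: "K > 0" "\<And>x y. norm (f x - f y) \<le> K * norm (x - y)"
  obtains x where "x 0 = x0" "\<And>t. t \<ge> 0 \<Longrightarrow> (x has_vector_derivative f (x t)) (at t within {0..})"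
proof -
  \<comment> \<open>This gives the contraction factor \<open>K / c = 1/2\<close>.\<close>
  define c where "c = 2 * K"
  have c: "c > 0" using K by (simp add: c_def)
  have contf: "continuous_on UNIV f"
    using K by (intro lipschitz_on_continuous_on[of K] lipschitz_onI) (auto simp: dist_norm)
  define h where "h y s = f (x0 + exp (c * s) *\<^sub>R apply_bcontfun y s)" for y :: "real \<Rightarrow>\<^sub>C 'a" and s
  \<comment> \<open>\<open>max 0 t\<close> continues the Picard map by zero to negative times, so
    that it acts on the Banach space of bounded continuous functions on the whole line.\<close>
  define g where "g y t = exp (- c * max 0 t) *\<^sub>R integral {0..max 0 t} (h y)" for y t
  have conth: "continuous_on UNIV (h y)" for y
    unfolding h_def by (intro continuous_on_compose2[OF contf] continuous_intros) auto
  have int: "h y integrable_on {0..t}" for y t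
    by (intro integrable_continuous_real continuous_on_subset[OF conth]) auto
  have contH: "continuous_on {0..} (\<lambda>t. integral {0..t} (h y))" for y
    by (rule continuous_on_vector_derivative, rule integral_has_vector_derivative_atLeast[OF conth]) auto
  have hb: "norm (h y s) \<le> (norm (f x0) + K * norm y) * exp (c * s)" if "s \<ge> 0" for y s
  proof -
    have "norm (h y s) \<le> norm (f x0) + norm (h y s - f x0)" by (rule norm_triangle_sub)
    also have "\<dots> \<le> norm (f x0) + K * (exp (c * s) * norm (apply_bcontfun y s))"
      using K(2)[of "x0 + exp (c * s) *\<^sub>R apply_bcontfun y s" x0] by (simp add: h_def)
    also have "\<dots> \<le> norm (f x0) * exp (c * s) + K * (exp (c * s) * norm y)"
      using K(1) c that norm_bounded[of y s]
      by (intro add_mono mult_left_mono) (auto simp: mult_le_cancel_left1)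
    finally show ?thesis by (simp add: algebra_simps)
  qed
  have g: "g y \<in> bcontfun" for y
  proof (rule bcontfun_normI)
    show "continuous_on UNIV (g y)"
      unfolding g_def by (intro continuous_intros continuous_on_compose2[OF contH]) auto
    show "norm (g y t) \<le> (norm (f x0) + K * norm y) / c" for t
      unfolding g_def using K(1) c by (intro norm_integral_exp_bound conth hb) auto
  qed
  define G where "G y = Bcontfun (g y)" for y
  have G: "apply_bcontfun (G y) = g y" for y
    unfolding G_def using g by (rule Bcontfun_inverse)
  have "dist (G y) (G z) \<le> 1 / 2 * dist y z" for y z
  proof (rule dist_bound)
    fix t
    have "norm (exp (- c * max 0 t) *\<^sub>R integral {0..max 0 t} (\<lambda>s. h y s - h z s)) \<le> (K * dist y z) / c"
    proof (rule norm_integral_exp_bound)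
      show "continuous_on UNIV (\<lambda>s. h y s - h z s)" by (intro continuous_intros conth)
      fix s :: real assume "s \<ge> 0"
      have "norm (h y s - h z s) \<le> K * (exp (c * s) * dist (apply_bcontfun y s) (apply_bcontfun z s))"
        unfolding h_def by (rule order_trans[OF K(2)]) (simp add: dist_norm scaleR_diff_right[symmetric])
      also have "\<dots> \<le> K * (exp (c * s) * dist y z)"
        using K(1) by (intro mult_left_mono dist_bounded) auto
      finally show "norm (h y s - h z s) \<le> K * dist y z * exp (c * s)" by (simp add: mult_ac)
    qed (use K c in auto)
    then show "dist (apply_bcontfun (G y) t) (apply_bcontfun (G z) t) \<le> 1 / 2 * dist y z"
      using K(1) by (simp add: G g_def dist_norm c_def scaleR_diff_right[symmetric]
          Henstock_Kurzweil_Integration.integral_diff[OF int int])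
  qed
  then obtain y where y: "G y = y"
    using banach_fix_type[of "1/2" G] by auto
  define x where "x t = x0 + exp (c * t) *\<^sub>R apply_bcontfun y t" for t
  have xI: "x t = x0 + integral {0..t} (h y)" if "t \<ge> 0" for t
  proof -
    have "apply_bcontfun y t = g y t" using G[of y] y by simp
    then show ?thesis using that by (simp add: x_def g_def exp_minus)
  qed
  show thesis
  proof (rule that[of x])
    show "x 0 = x0" using xI[of 0] by simp
    fix t :: real assume t: "t \<ge> 0"
    have "((\<lambda>u. x0 + integral {0..u} (h y)) has_vector_derivative 0 + h y t) (at t within {0..})"
      by (intro has_vector_derivative_add has_vector_derivative_const
          integral_has_vector_derivative_atLeast conth t)
    then have "(x has_vector_derivative h y t) (at t within {0..})"
      using t xI by (subst has_vector_derivative_cong_ev[where g = "\<lambda>u. x0 + integral {0..u} (h y)"]) auto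
    then show "(x has_vector_derivative f (x t)) (at t within {0..})" by (simp add: h_def x_def)
  qed
qed

section \<open>Exponential decay of the field along its trajectories\<close>

locale dissipative_field =
  fixes f :: "'a::euclidean_space \<Rightarrow> 'a" and J :: "'a \<Rightarrow> 'a" and c :: 'a and r m :: real
  assumes bounded_linear_J: "bounded_linear J"
    and norm_J_le: "norm (J z) \<le> norm z"
    and dissipative: "z \<bullet> J z = - (norm (J z))\<^sup>2"
    and m: "0 < m" "m \<le> 1"
    and coercive: "x \<in> ball c r \<Longrightarrow> m * norm (f x) \<le> norm (J (f x))"
    and strict: "x \<in> ball c r \<Longrightarrow> y \<in> ball c r \<Longrightarrow> norm (f x - f y - J (x - y)) \<le> m\<^sup>2 / 4 * norm (x - y)"
begin

abbreviation \<mu> :: real where "\<mu> \<equiv> m\<^sup>2 / 4"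

lemma rate: "0 < \<mu>" "\<mu> \<le> 1 / 4"
  using m by (auto simp: power_le_one)

section \<open>Estimates over a short time step\<close>

lemma lipschitz:
  assumes "x \<in> ball c r" "y \<in> ball c r"
  shows "norm (f x - f y) \<le> 2 * norm (x - y)"
proof -
  have "norm (f x - f y) \<le> norm (J (x - y)) + norm (f x - f y - J (x - y))" by (rule norm_triangle_sub)
  also have "\<dots> \<le> norm (x - y) + 1 * norm (x - y)"
    using rate(2) by (intro add_mono norm_J_le order_trans[OF strict[OF assms]] mult_right_mono) auto
  finally show ?thesis by simp
qed

text \<open>By dissipativity the squared norm changes by
  \<open>- h * (2 - h) * (norm (J (f x)))\<^sup>2\<close>; \<open>h \<le> 1\<close> and coercivity
  leave the factor \<open>1 - 4 * \<mu> * h\<close>, which is at most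
  \<open>(1 - 2 * \<mu> * h)\<^sup>2\<close>.\<close>

lemma euler_step:
  assumes "x \<in> ball c r" "0 \<le> h" "h \<le> 1"
  shows "norm (f x + h *\<^sub>R J (f x)) \<le> (1 - 2 * \<mu> * h) * norm (f x)"
proof (rule power2_le_imp_le)
  let ?p = "f x"
  have m1: "h * m\<^sup>2 \<le> 1" using assms m by (intro mult_le_one) (auto simp: power_le_one)
  have "(norm (?p + h *\<^sub>R J ?p))\<^sup>2 = (norm ?p)\<^sup>2 + 2 * (?p \<bullet> h *\<^sub>R J ?p) + (norm (h *\<^sub>R J ?p))\<^sup>2"
    unfolding power2_norm_eq_inner by (simp only: inner_add_left inner_add_right) (simp add: inner_commute)
  also have "\<dots> = (norm ?p)\<^sup>2 + 2 * h * (?p \<bullet> J ?p) + h\<^sup>2 * (norm (J ?p))\<^sup>2"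
    by (simp add: power_mult_distrib)
  also have "\<dots> = (norm ?p)\<^sup>2 - h * (2 - h) * (norm (J ?p))\<^sup>2"
    by (simp add: dissipative algebra_simps power2_eq_square)
  also have "\<dots> \<le> (norm ?p)\<^sup>2 - h * 1 * (m * norm ?p)\<^sup>2"
    using assms m by (intro diff_left_mono mult_mono power_mono coercive) auto
  also have "\<dots> = (1 - 2 * (2 * \<mu> * h)) * (norm ?p)\<^sup>2"
    by (simp add: power_mult_distrib left_diff_distrib)
  also have "\<dots> \<le> (1 - 2 * \<mu> * h)\<^sup>2 * (norm ?p)\<^sup>2"
    by (rule mult_right_mono) (simp_all add: power2_diff)
  also have "\<dots> = ((1 - 2 * \<mu> * h) * norm ?p)\<^sup>2" by (simp add: power_mult_distrib)
  finally show "(norm (?p + h *\<^sub>R J ?p))\<^sup>2 \<le> ((1 - 2 * \<mu> * h) * norm ?p)\<^sup>2" .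
  show "0 \<le> (1 - 2 * \<mu> * h) * norm ?p" using m1 by (intro mult_nonneg_nonneg) (auto simp: algebra_simps)
qed

text \<open>Over a short time \<open>h\<close> the value of \<open>f\<close> changes, up to small
  errors, by \<open>h\<close> times \<open>J\<close> of itself: an Euler step, contracting at rate
  \<open>2 * \<mu>\<close>. The strict derivative error consumes \<open>\<mu>\<close> of it, and all
  else goes into \<open>\<eta>\<close>. The time interval straddles \<open>\<tau>\<close>, as
  bisection requires.\<close>

lemma approximate_decay_near:
  assumes sol: "(x has_vector_derivative f (x \<tau>)) (at \<tau> within {0..T})" and "\<tau> \<in> {0..T}"
    and B: "\<And>t. t \<in> {0..T} \<Longrightarrow> x t \<in> ball c r" and "\<eta> > 0"
  obtains d where "d > 0" "\<And>s t. s \<in> {0..T} \<Longrightarrow> t \<in> {0..T} \<Longrightarrow> s \<le> \<tau> \<Longrightarrow> \<tau> \<le> t \<Longrightarrow> t - s < d \<Longrightarrow>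
    norm (f (x t)) \<le> exp (- \<mu> * (t - s)) * norm (f (x s)) + \<eta> * (t - s)"
proof -
  interpret J: bounded_linear J by (rule bounded_linear_J)
  define u where "u = f (x \<tau>)"
  \<comment> \<open>Four errors of size \<open>h * \<kappa>\<close> will add up to
    \<open>\<eta> * h\<close>.\<close>
  define \<kappa> where "\<kappa> = \<eta> / 4"
  have \<kappa>: "\<kappa> > 0" using assms by (simp add: \<kappa>_def)
  obtain d1 where d1: "d1 > 0" "\<And>t. t \<in> {0..T} \<Longrightarrow> \<bar>t - \<tau>\<bar> < d1 \<Longrightarrow>
      norm (x t - x \<tau> - (t - \<tau>) *\<^sub>R u) \<le> \<kappa> * \<bar>t - \<tau>\<bar>"
    using sol \<kappa> unfolding has_vector_derivative_def has_derivative_within_alt u_def by force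
  have "continuous (at \<tau> within {0..T}) x" using sol by (rule has_vector_derivative_continuous)
  \<comment> \<open>\<open>\<kappa> / 2\<close>, since \<open>f\<close> is 2-Lipschitz on the ball
    and its values are to be \<open>\<kappa>\<close>-close.\<close>
  then obtain d2 where d2: "d2 > 0" "\<And>t. t \<in> {0..T} \<Longrightarrow> \<bar>t - \<tau>\<bar> < d2 \<Longrightarrow> norm (x t - x \<tau>) < \<kappa> / 2"
    using \<kappa> unfolding continuous_within_eps_delta dist_norm by (metis half_gt_zero real_norm_def)
  show thesis
  proof (rule that[of "Min {1, d1, d2}"])
    show "Min {1, d1, d2} > 0" using d1(1) d2(1) by simp
    fix s t assume st: "s \<in> {0..T}" "t \<in> {0..T}" "s \<le> \<tau>" "\<tau> \<le> t" "t - s < Min {1, d1, d2}"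
    define h where "h = t - s"
    have h: "0 \<le> h" "h \<le> 1" using st by (auto simp: h_def)
    define p where "p = f (x s)"
    have "norm (x s - x \<tau>) < \<kappa> / 2" using st by (intro d2(2)) auto
    then have pu: "norm (p - u) \<le> \<kappa>"
      using lipschitz[OF B[OF st(1)] B[OF assms(2)]] by (simp add: p_def u_def)
    have "norm ((x t - x \<tau> - (t - \<tau>) *\<^sub>R u) - (x s - x \<tau> - (s - \<tau>) *\<^sub>R u))
        \<le> \<kappa> * \<bar>t - \<tau>\<bar> + \<kappa> * \<bar>s - \<tau>\<bar>"
      using st by (intro norm_triangle_le_diff add_mono d1(2)) auto
    moreover have "(x t - x \<tau> - (t - \<tau>) *\<^sub>R u) - (x s - x \<tau> - (s - \<tau>) *\<^sub>R u) = x t - x s - h *\<^sub>R u"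
      by (simp add: h_def algebra_simps)
    moreover have "\<kappa> * \<bar>t - \<tau>\<bar> + \<kappa> * \<bar>s - \<tau>\<bar> = h * \<kappa>" using st by (simp add: h_def algebra_simps)
    ultimately have \<Delta>: "norm (x t - x s - h *\<^sub>R u) \<le> h * \<kappa>" by simp
    have hu: "norm (h *\<^sub>R (u - p)) \<le> h * \<kappa>"
      using pu h by (simp add: norm_minus_commute mult_left_mono)
    have "norm (x t - x s) \<le> norm (h *\<^sub>R p) + (h * \<kappa> + h * \<kappa>)"
    proof -
      have "x t - x s = h *\<^sub>R p + ((x t - x s - h *\<^sub>R u) + h *\<^sub>R (u - p))" by (simp add: algebra_simps)
      also have "norm \<dots> \<le> norm (h *\<^sub>R p) + (h * \<kappa> + h * \<kappa>)"
        by (intro norm_triangle_le add_mono order_refl \<Delta> hu)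
      finally show ?thesis .
    qed
    then have "norm (x t - x s) \<le> h * norm p + 2 * (h * \<kappa>)" using h by (simp add: mult_ac)
    then have "\<mu> * norm (x t - x s) \<le> \<mu> * (h * norm p + 2 * (h * \<kappa>))"
      by (rule mult_left_mono[OF _ less_imp_le[OF rate(1)]])
    moreover have "\<mu> * (2 * (h * \<kappa>)) \<le> 1 * (2 * (h * \<kappa>))"
      using rate(2) h \<kappa> by (intro mult_right_mono) auto
    ultimately have \<Delta>': "\<mu> * norm (x t - x s) \<le> \<mu> * h * norm p + 2 * (h * \<kappa>)"
      by (simp add: distrib_left mult.assoc)
    \<comment> \<open>An Euler step from \<open>p\<close>, the strict derivative error, and
      \<open>J\<close> applied to two displacement errors, the second from replacing
      \<open>f (x s)\<close> by \<open>f (x \<tau>)\<close>.\<close>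
    have "f (x t) = (p + h *\<^sub>R J p) + ((f (x t) - f (x s) - J (x t - x s))
        + (J (x t - x s - h *\<^sub>R u) + J (h *\<^sub>R (u - p))))"
      by (simp add: p_def J.diff J.scaleR J.add algebra_simps)
    also have "norm \<dots> \<le> (1 - 2 * \<mu> * h) * norm p
        + (\<mu> * norm (x t - x s) + (h * \<kappa> + h * \<kappa>))"
      unfolding p_def
      by (intro norm_triangle_le add_mono euler_step strict B st h order_trans[OF norm_J_le \<Delta>]
          order_trans[OF norm_J_le hu[unfolded p_def]])
    also have "\<dots> \<le> (1 - \<mu> * h) * norm p + \<eta> * h"
      using \<Delta>' by (simp add: \<kappa>_def algebra_simps)
    also have "\<dots> \<le> exp (- \<mu> * h) * norm p + \<eta> * h"
      using exp_ge_add_one_self[of "- \<mu> * h"] by (intro add_right_mono mult_right_mono) auto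
    finally show "norm (f (x t)) \<le> exp (- \<mu> * (t - s)) * norm (f (x s)) + \<eta> * (t - s)"
      by (simp add: h_def p_def)
  qed
qed

text \<open>
  \<open>f\<close> need not be differentiable off \<open>c\<close>, so no derivative of \<open>f (x t)\<close> is available; the
  infinitesimal estimates are glued by bisection instead.
\<close>

lemma decay_while_inside:
  assumes sol: "\<And>t. t \<ge> 0 \<Longrightarrow> (x has_vector_derivative f (x t)) (at t within {0..})"
    and B: "\<And>t. t \<in> {0..T} \<Longrightarrow> x t \<in> ball c r" and T: "T \<ge> 0"
  shows "norm (f (x T)) \<le> exp (- \<mu> * T) * norm (f (x 0))"
proof (rule field_le_epsilon)
  fix e :: real assume "e > 0"
  define \<eta> where "\<eta> = e / (T + 1)"
  have \<eta>: "\<eta> > 0" using \<open>e > 0\<close> T by (simp add: \<eta>_def)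
  \<comment> \<open>The guards make \<open>Q\<close> vacuous for intervals that leave
    \<open>[0, T]\<close>, which the local step of the bisection also ranges over.\<close>
  define Q where "Q s t \<longleftrightarrow> (0 \<le> s \<longrightarrow> t \<le> T \<longrightarrow>
    norm (f (x t)) \<le> exp (- \<mu> * (t - s)) * norm (f (x s)) + \<eta> * (t - s))" for s t
  have "Q 0 T"
    using T
  proof (induction rule: Bolzano)
    case (trans s t u)
    show ?case unfolding Q_def
    proof (intro impI)
      assume *: "0 \<le> s" "u \<le> T"
      have "- a * (u - t) + - a * (t - s) = - a * (u - s)" for a :: real by (simp add: algebra_simps)
      then have E: "exp (- \<mu> * (u - t)) * exp (- \<mu> * (t - s)) = exp (- \<mu> * (u - s))"
        by (simp only: mult_exp_exp)
      have "norm (f (x u)) \<le> exp (- \<mu> * (u - t)) * norm (f (x t)) + \<eta> * (u - t)"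
        using trans * by (simp add: Q_def)
      also have "\<dots> \<le> exp (- \<mu> * (u - t)) * (exp (- \<mu> * (t - s)) * norm (f (x s)) + \<eta> * (t - s)) + \<eta> * (u - t)"
        using trans * by (intro add_right_mono mult_left_mono) (auto simp: Q_def)
      also have "\<dots> = exp (- \<mu> * (u - s)) * norm (f (x s)) + exp (- \<mu> * (u - t)) * (\<eta> * (t - s)) + \<eta> * (u - t)"
        by (simp only: distrib_left mult.assoc[symmetric] E)
      \<comment> \<open>The exponential is at most \<open>1\<close>, so the errors merely add up and
        stay proportional to the length of the interval.\<close>
      also have "\<dots> \<le> exp (- \<mu> * (u - s)) * norm (f (x s)) + 1 * (\<eta> * (t - s)) + \<eta> * (u - t)"
        using trans rate \<eta> by (intro add_mono mult_right_mono) (auto simp: mult_le_0_iff)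
      finally show "norm (f (x u)) \<le> exp (- \<mu> * (u - s)) * norm (f (x s)) + \<eta> * (u - s)"
        by (simp add: algebra_simps)
    qed
  next
    case (local \<tau>)
    then have \<tau>: "\<tau> \<in> {0..T}" by simp
    have "(x has_vector_derivative f (x \<tau>)) (at \<tau> within {0..T})"
      by (rule has_vector_derivative_within_subset[OF sol]) (use \<tau> in auto)
    from approximate_decay_near[OF this \<tau> B \<eta>] obtain d where d: "d > 0"
      "\<And>s t. s \<in> {0..T} \<Longrightarrow> t \<in> {0..T} \<Longrightarrow> s \<le> \<tau> \<Longrightarrow> \<tau> \<le> t \<Longrightarrow> t - s < d \<Longrightarrow>
        norm (f (x t)) \<le> exp (- \<mu> * (t - s)) * norm (f (x s)) + \<eta> * (t - s)"
      by blast
    show ?case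
    proof (intro exI conjI allI impI)
      fix s t assume *: "s \<le> \<tau> \<and> \<tau> \<le> t \<and> t - s < d"
      show "Q s t" unfolding Q_def
      proof (intro impI)
        assume "0 \<le> s" "t \<le> T"
        then show "norm (f (x t)) \<le> exp (- \<mu> * (t - s)) * norm (f (x s)) + \<eta> * (t - s)"
          using * \<tau> by (intro d(2)) auto
      qed
    qed (rule d(1))
  qed
  then have "norm (f (x T)) \<le> exp (- \<mu> * T) * norm (f (x 0)) + \<eta> * T" by (simp add: Q_def)
  moreover have "\<eta> * T \<le> e" using \<open>e > 0\<close> T by (simp add: \<eta>_def field_simps)
  ultimately show "norm (f (x T)) \<le> exp (- \<mu> * T) * norm (f (x 0)) + e" by simp
qed

text \<open>\<open>norm (f (x t))\<close> is the speed, and the integral of its exponential bound is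
  at most \<open>norm (f (x 0)) / \<mu>\<close> whatever \<open>T\<close>.\<close>

lemma displacement_while_inside:
  assumes sol: "\<And>t. t \<ge> 0 \<Longrightarrow> (x has_vector_derivative f (x t)) (at t within {0..})"
    and B: "\<And>t. t \<in> {0..T} \<Longrightarrow> x t \<in> ball c r" and T: "T \<ge> 0"
  shows "norm (x T - x 0) \<le> norm (f (x 0)) / \<mu>"
proof (cases "T = 0")
  case False
  have deriv: "((\<lambda>t. - (g / a) * exp (- a * t)) has_vector_derivative exp (- a * t) * g) (at t)"
    if "a > 0" for a g t :: real
    using that by (auto intro!: derivative_eq_intros simp: has_real_derivative_iff_has_vector_derivative[symmetric])
  let ?\<phi> = "\<lambda>t. - (norm (f (x 0)) / \<mu>) * exp (- \<mu> * t)"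
  have "norm (x T - x 0) \<le> ?\<phi> T - ?\<phi> 0"
  proof (rule differentiable_bound_general[where f' = "\<lambda>t. f (x t)"
        and \<phi>' = "\<lambda>t. exp (- \<mu> * t) * norm (f (x 0))"])
    show "continuous_on {0..T} x"
      by (rule continuous_on_vector_derivative, rule has_vector_derivative_within_subset[OF sol]) auto
    show "continuous_on {0..T} ?\<phi>" by (intro continuous_intros)
    fix t assume t: "0 < t" "t < T"
    show "(x has_vector_derivative f (x t)) (at t)"
      using sol[of t] t at_within_interior[of t "{0..}"] by simp
    show "(?\<phi> has_vector_derivative exp (- \<mu> * t) * norm (f (x 0))) (at t)"
      by (rule deriv[OF rate(1)])
    show "norm (f (x t)) \<le> exp (- \<mu> * t) * norm (f (x 0))"
      using t by (intro decay_while_inside sol B) auto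
  qed (use False T in auto)
  also have "\<dots> \<le> norm (f (x 0)) / \<mu>" using rate by simp
  finally show ?thesis .
qed (use rate in simp)

text \<open>First-exit argument. Before the first time \<open>s\<close> outside the open ball, the
  displacement bound keeps the trajectory within distance \<open>\<rho> < r\<close> of
  \<open>c\<close>; by continuity this holds at \<open>s\<close> too, a contradiction.\<close>

lemma trapped:
  assumes sol: "\<And>t. t \<ge> 0 \<Longrightarrow> (x has_vector_derivative f (x t)) (at t within {0..})"
    and x0: "dist c (x 0) + norm (f (x 0)) / \<mu> < r" and "t \<ge> 0"
  shows "x t \<in> ball c r" "norm (f (x t)) \<le> exp (- \<mu> * t) * norm (f (x 0))"
proof -
  define \<rho> where "\<rho> = dist c (x 0) + norm (f (x 0)) / \<mu>"
  have inside: "x t \<in> ball c r" if "t \<ge> 0" for t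
  proof (rule ccontr)
    assume out: "x t \<notin> ball c r"
    have cont: "continuous_on {0..t} x"
      by (rule continuous_on_vector_derivative, rule has_vector_derivative_within_subset[OF sol]) auto
    define E where "E = {s \<in> {0..t}. r \<le> dist c (x s)}"
    have "closed E"
      unfolding E_def by (intro continuous_on_closed_Collect_le continuous_intros cont closed_atLeastAtMost)
    moreover have "E \<subseteq> {0..t}" by (auto simp: E_def)
    ultimately have "compact E" by (metis compact_Icc compact_Int_closed inf.absorb_iff2)
    moreover have "t \<in> E" using out that by (auto simp: E_def)
    ultimately obtain s where s: "s \<in> E" "\<And>q. q \<in> E \<Longrightarrow> s \<le> q"
      using compact_attains_inf[of E] by blast
    have before: "x q \<in> ball c r" if "q \<in> {0..<s}" for q
      using s(2)[of q] s(1) that by (force simp: E_def)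
    have "r > \<rho>" using x0 by (simp add: \<rho>_def)
    have "s > 0"
      using s(1) x0 rate divide_nonneg_pos[OF norm_ge_zero rate(1), of "f (x 0)"]
      by (cases "s = 0") (auto simp: E_def)
    have "dist c (x q) \<le> \<rho>" if q: "q \<in> {0..<s}" for q
    proof -
      have "norm (x q - x 0) \<le> norm (f (x 0)) / \<mu>"
        using q by (intro displacement_while_inside sol before) auto
      then show ?thesis
        using dist_triangle[of c "x q" "x 0"] by (simp add: \<rho>_def dist_norm norm_minus_commute)
    qed
    moreover have "continuous (at s within {0..<s}) x"
      using s(1) by (intro continuous_within_subset[OF has_vector_derivative_continuous[OF sol]]) (auto simp: E_def)
    moreover have "at s within {0..<s} \<noteq> bot"
      using \<open>s > 0\<close> by (simp add: at_within_eq_bot_iff)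
    ultimately have "dist c (x s) \<le> \<rho>"
      by (intro tendsto_upperbound[of "\<lambda>q. dist c (x q)" _ "at s within {0..<s}"])
        (auto simp: continuous_within eventually_at_filter intro!: tendsto_intros)
    then show False using s(1) \<open>r > \<rho>\<close> by (simp add: E_def)
  qed
  show "x t \<in> ball c r" using \<open>t \<ge> 0\<close> by (rule inside)
  show "norm (f (x t)) \<le> exp (- \<mu> * t) * norm (f (x 0))"
    using \<open>t \<ge> 0\<close> by (intro decay_while_inside sol inside) auto
qed

text \<open>The hypotheses on the field see only its values in the ball, so a field changed outside
  a smaller ball satisfies them there.\<close>

lemma restrict:
  assumes "s \<le> r" "\<And>x. x \<in> ball c s \<Longrightarrow> g x = f x"
  shows "dissipative_field g J c s m"
  using assms coercive strict
  by (intro dissipative_field.intro bounded_linear_J norm_J_le dissipative m) simp_all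

text \<open>Composing with the projection onto a smaller ball makes the field globally Lipschitz.\<close>

lemma solution_exists:
  assumes x0: "dist c x0 + norm (f x0) / \<mu> < s" and s: "s < r"
  obtains x where "x 0 = x0" "\<And>t. t \<ge> 0 \<Longrightarrow> (x has_vector_derivative f (x t)) (at t within {0..})"
proof -
  have dist_s: "dist c x0 < s"
    using x0 divide_nonneg_pos[OF norm_ge_zero rate(1), of "f x0"] by linarith
  then have "0 < s" using zero_le_dist[of c x0] by linarith
  \<comment> \<open>\<open>s < r\<close> keeps the closed ball inside the region where
    \<open>f\<close> is Lipschitz, and projecting onto it does not increase distances.\<close>
  define \<pi> where "\<pi> = closest_point (cball c s)"
  have \<pi>: "\<pi> y \<in> ball c r" for y
    using closest_point_in_set[of "cball c s" y] \<open>0 < s\<close> s by (simp add: \<pi>_def)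
  have \<pi>_id: "\<pi> y = y" if "y \<in> ball c s" for y
    unfolding \<pi>_def using that by (intro closest_point_self) simp
  have "norm (f (\<pi> y) - f (\<pi> z)) \<le> 2 * norm (y - z)" for y z
  proof -
    have "norm (f (\<pi> y) - f (\<pi> z)) \<le> 2 * norm (\<pi> y - \<pi> z)" by (intro lipschitz \<pi>)
    also have "norm (\<pi> y - \<pi> z) \<le> norm (y - z)"
      using closest_point_lipschitz[of "cball c s" y z] \<open>0 < s\<close> by (simp add: \<pi>_def dist_norm)
    finally show ?thesis by simp
  qed
  then obtain x where x: "x 0 = x0"
    "\<And>t. t \<ge> 0 \<Longrightarrow> (x has_vector_derivative f (\<pi> (x t))) (at t within {0..})"
    using lipschitz_field_solution_exists[of 2 "\<lambda>y. f (\<pi> y)" x0] by auto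
  \<comment> \<open>The trajectory of the modified field is trapped in \<open>ball c s\<close>,
    where \<open>\<pi>\<close> is the identity, so it is a trajectory of \<open>f\<close>.\<close>
  interpret \<pi>: dissipative_field "\<lambda>y. f (\<pi> y)" J c s m
    using s by (intro restrict) (simp_all add: \<pi>_id)
  have "x t \<in> ball c s" if "t \<ge> 0" for t
    using x0 dist_s that by (intro \<pi>.trapped(1) x(2)) (simp_all add: x(1) \<pi>_id)
  then show thesis using that[of x] x \<pi>_id by force
qed

text \<open>As \<open>f\<close> is 2-Lipschitz and vanishes at \<open>c\<close>, the quantity is at
  most \<open>(1 + 2 / \<mu>) * dist c x\<close>, whence the radius. Its smallness is what
  \<open>trapped\<close> asks of the starting point.\<close>

lemma small_near_equilibrium:
  assumes "f c = 0" "0 < s" "s \<le> r"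
  obtains d where "d > 0" "\<And>x. x \<in> ball c d \<Longrightarrow> dist c x + norm (f x) / \<mu> < s"
proof (rule that[of "s / (1 + 2 / \<mu>)"])
  have pos: "1 + 2 / \<mu> > 0" using rate(1) by (intro add_pos_pos divide_pos_pos) auto
  then show "s / (1 + 2 / \<mu>) > 0" using assms by simp
  fix x assume "x \<in> ball c (s / (1 + 2 / \<mu>))"
  then have x: "dist c x * (1 + 2 / \<mu>) < s" using pos by (simp add: pos_less_divide_eq)
  have "dist c x * 1 \<le> dist c x * (1 + 2 / \<mu>)" using rate(1) by (intro mult_left_mono) auto
  then have "x \<in> ball c r" using x assms by simp
  moreover have "c \<in> ball c r" using assms by simp
  ultimately have "norm (f x) \<le> 2 * dist c x"
    using lipschitz[of x c] assms(1) by (simp add: dist_norm norm_minus_commute)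
  then have "norm (f x) / \<mu> \<le> 2 * dist c x / \<mu>" by (rule divide_right_mono) (use rate in simp)
  then show "dist c x + norm (f x) / \<mu> < s" using x by (simp add: distrib_left mult_ac)
qed

end

section \<open>The RRR flow at a transversal intersection\<close>

lemma rrr_field_eq_0: "x \<in> A \<Longrightarrow> x \<in> B \<Longrightarrow> rrr_field A B x = 0"
  by (simp add: rrr_field_def reflection_def closest_point_self scaleR_2)

lemma rrr_field_dissipative:
  fixes A B :: "'a::euclidean_space set"
  assumes "closed A" "closed B" "C2_submanifold k A" "C2_submanifold l B" "transversal_at A B p"
  obtains J r m where "r > 0" "dissipative_field (rrr_field A B) J p r m"
proof -
  have p: "p \<in> A" "p \<in> B" using assms(5) by (auto simp: transversal_at_def)
  obtain T P where P: "orthogonal_projector T P" "tangent_space A p \<subseteq> T"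
    "has_strict_derivative (closest_point A) P p"
    using closest_point_has_strict_derivative[OF assms(1,3) p(1)] .
  obtain N Q where Q: "orthogonal_projector N Q" "tangent_space B p \<subseteq> N"
    "has_strict_derivative (closest_point B) Q p"
    using closest_point_has_strict_derivative[OF assms(2,4) p(2)] .
  have "{a + b | a b. a \<in> tangent_space A p \<and> b \<in> tangent_space B p} = UNIV"
    using assms(5) by (simp add: transversal_at_def)
  \<comment> \<open>\<open>T\<close> and \<open>N\<close> contain the tangent spaces, so their sum
    is still the whole space.\<close>
  then have sum: "{a + b | a b. a \<in> T \<and> b \<in> N} = UNIV" using P(2) Q(2) by blast
  obtain m r1 where m: "m > 0" "r1 > 0" "\<And>x. x \<in> ball p r1 \<Longrightarrow>
      m * norm (rrr_field A B x) \<le> norm (rrr_linear P Q (rrr_field A B x))"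
    using rrr_linear_coercive_on_field[OF assms(1,2) p P(1,3) Q(1,3) sum] by metis
  define m' where "m' = min m 1"
  have m': "0 < m'" "m' \<le> 1" "m' \<le> m" using m by (auto simp: m'_def)
  then have "m'\<^sup>2 / 4 > 0" by simp
  then obtain r2 where r2: "r2 > 0" "\<And>x y. x \<in> ball p r2 \<Longrightarrow> y \<in> ball p r2 \<Longrightarrow>
      norm (rrr_field A B x - rrr_field A B y - rrr_linear P Q (x - y)) \<le> m'\<^sup>2 / 4 * norm (x - y)"
    using has_strict_derivativeE[OF rrr_field_has_strict_derivative[OF p(1) P(3) Q(3)]] by metis
  have "dissipative_field (rrr_field A B) (rrr_linear P Q) p (min r1 r2) m'"
  proof (rule dissipative_field.intro)
    show "bounded_linear (rrr_linear P Q)"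
      by (rule rrr_linear_bounded_linear[OF orthogonal_projectorD(2)[OF P(1)] orthogonal_projectorD(2)[OF Q(1)]])
    show "m' * norm (rrr_field A B x) \<le> norm (rrr_linear P Q (rrr_field A B x))"
      if "x \<in> ball p (min r1 r2)" for x
      using m(3)[of x] mult_right_mono[OF m'(3) norm_ge_zero[of "rrr_field A B x"]] that by simp
  qed (use rrr_linear_norm_le[OF P(1) Q(1)] rrr_linear_dissipative[OF P(1) Q(1)] m' r2(2) in auto)
  then show thesis using that m(2) r2(1) by (metis min_less_iff_conj)
qed

text \<open>\<open>t\<close> is the time at which the decay bound equals \<open>\<delta>\<close>; it
  is nonnegative because \<open>q \<ge> 1\<close>.\<close>

lemma hitting_time_le_of_decay:
  assumes "\<mu> > 0" "C > 0" "\<delta> > 0" "C * norm (rrr_field A B (x 0)) \<ge> \<delta>"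
    and decay: "\<And>t. t \<ge> 0 \<Longrightarrow> norm (rrr_field A B (x t)) \<le> C * exp (- \<mu> * t) * norm (rrr_field A B (x 0))"
  shows "hitting_time A B \<delta> x \<le> ereal (inverse \<mu> * ln (C * norm (rrr_field A B (x 0)) / \<delta>))"
proof -
  define q where "q = C * norm (rrr_field A B (x 0)) / \<delta>"
  have q: "q \<ge> 1" using assms by (simp add: q_def)
  define t where "t = inverse \<mu> * ln q"
  have t: "t \<ge> 0" using q assms by (simp add: t_def)
  have "\<mu> * t = ln q" using assms(1) by (simp add: t_def)
  then have "exp (- \<mu> * t) = inverse q" using q by (simp add: exp_minus)
  moreover have "q * \<delta> = C * norm (rrr_field A B (x 0))" using assms by (simp add: q_def)
  moreover have "C * exp (- \<mu> * t) * norm (rrr_field A B (x 0))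
      = exp (- \<mu> * t) * (C * norm (rrr_field A B (x 0)))"
    by (simp only: mult_ac)
  ultimately have "C * exp (- \<mu> * t) * norm (rrr_field A B (x 0)) = inverse q * (q * \<delta>)" by simp
  also have "\<dots> = \<delta>" using q by simp
  finally have "norm (rrr_field A B (x t)) \<le> \<delta>" using decay[OF t] by linarith
  then have "hitting_time A B \<delta> x \<le> ereal t"
    unfolding hitting_time_def using t by (intro Inf_lower) auto
  then show ?thesis by (simp add: t_def q_def)
qed

theorem theorem3p1:
  fixes A B :: "(real ^ 'm) set" and xstar :: "real ^ 'm" and k l :: nat
  assumes "closed A" and "closed B"
    and "C2_submanifold k A" and "C2_submanifold l B"
    and "transversal_at A B xstar"
  shows "rrr_field A B xstar = 0 \<and>
    (\<exists>\<mu>>0. \<exists>C\<ge>1. \<exists>U. open U \<and> xstar \<in> U \<and>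
      (\<forall>x0\<in>U. \<exists>x. rrr_solution A B x \<and> x 0 = x0) \<and>
      (\<forall>x. rrr_solution A B x \<and> x 0 \<in> U \<longrightarrow>
        (\<forall>t\<ge>0. norm (rrr_field A B (x t)) \<le> C * exp (- \<mu> * t) * norm (rrr_field A B (x 0)))) \<and>
      (\<forall>\<delta>>0. \<forall>x. rrr_solution A B x \<and> x 0 \<in> U \<and> norm (rrr_field A B (x 0)) > \<delta> \<longrightarrow>
        hitting_time A B \<delta> x \<le> ereal (inverse \<mu> * ln (C * norm (rrr_field A B (x 0)) / \<delta>)) \<and>
        hitting_time A B \<delta> x < \<infinity>))"
proof -
  have xstar: "xstar \<in> A" "xstar \<in> B" using assms(5) by (auto simp: transversal_at_def)
  have v0: "rrr_field A B xstar = 0" using xstar by (rule rrr_field_eq_0)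
  obtain J r m where r: "r > 0" and "dissipative_field (rrr_field A B) J xstar r m"
    using rrr_field_dissipative[OF assms] .
  then interpret dissipative_field "rrr_field A B" J xstar r m by simp
  \<comment> \<open>\<open>r / 2\<close> instead of \<open>r\<close> leaves the margin that
    \<open>solution_exists\<close> demands between its two radii.\<close>
  obtain d where d: "d > 0" "\<And>x. x \<in> ball xstar d \<Longrightarrow> dist xstar x + norm (rrr_field A B x) / \<mu> < r / 2"
    using small_near_equilibrium[OF v0, of "r / 2"] r by auto
  have exist: "\<exists>x. rrr_solution A B x \<and> x 0 = x0" if "x0 \<in> ball xstar d" for x0
  proof -
    have "r / 2 < r" using r by simp
    from solution_exists[OF d(2)[OF that] this]
    show ?thesis unfolding rrr_solution_def by metis
  qed
  \<comment> \<open>The decay is in the Euclidean norm itself, so \<open>C = 1\<close> will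
    do.\<close>
  have decay: "norm (rrr_field A B (x t)) \<le> 1 * exp (- \<mu> * t) * norm (rrr_field A B (x 0))"
    if "rrr_solution A B x" "x 0 \<in> ball xstar d" "t \<ge> 0" for x t
    using trapped(2)[of x t] d(2)[OF that(2)] r that(1,3) unfolding rrr_solution_def by simp
  have hit: "hitting_time A B \<delta> x \<le> ereal (inverse \<mu> * ln (1 * norm (rrr_field A B (x 0)) / \<delta>))"
    if "\<delta> > 0" "rrr_solution A B x" "x 0 \<in> ball xstar d" "norm (rrr_field A B (x 0)) > \<delta>" for \<delta> x
    using that by (intro hitting_time_le_of_decay rate(1) decay) auto
  show ?thesis
  proof (rule conjI[OF v0], rule exI[of _ \<mu>], rule conjI[OF rate(1)], rule exI[of _ 1],
      rule conjI[OF order_refl], rule exI[of _ "ball xstar d"], intro conjI allI impI ballI)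
    show "open (ball xstar d)" by (rule open_ball)
    show "xstar \<in> ball xstar d" using d(1) by simp
    show "\<exists>x. rrr_solution A B x \<and> x 0 = x0" if "x0 \<in> ball xstar d" for x0
      using that by (rule exist)
    show "norm (rrr_field A B (x t)) \<le> 1 * exp (- \<mu> * t) * norm (rrr_field A B (x 0))"
      if "rrr_solution A B x \<and> x 0 \<in> ball xstar d" "t \<ge> 0" for x t
      using that by (intro decay) auto
    fix \<delta> :: real and x
    assume "\<delta> > 0" and x: "rrr_solution A B x \<and> x 0 \<in> ball xstar d \<and> norm (rrr_field A B (x 0)) > \<delta>"
    then show *: "hitting_time A B \<delta> x \<le> ereal (inverse \<mu> * ln (1 * norm (rrr_field A B (x 0)) / \<delta>))"
      by (intro hit) auto
    then show "hitting_time A B \<delta> x < \<infinity>" by (rule order_le_less_trans) simp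
  qed
qed

end
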